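(* Let $N$ be a positive integer and let $0<p<\infty$ satisfy $Np>1$. Then the class $\mathfrak{R}_N(i)$ of rational functions of the form $f(z)=(z+i)^{-N-1}P\big((z+i)^{-1}\big)$, where $P$ ranges over all polynomials with complex coefficients, is dense in the Hardy space $H^p(\mathbb{C}_{+1})$.
   Context: $\mathbb{C}_{+1}=\{z=x+iy: y>0\}$ is the upper half plane. For $0<p<\infty$, $H^p(\mathbb{C}_{+1})$ is the space of functions $f$ analytic in $\mathbb{C}_{+1}$ with $\|f\|_{H^p_{+1}}=\sup_{y>0}\left(\int_{-\infty}^{\infty}|f(x+iy)|^p\,dx\right)^{1/p}<\infty$. Density is with respect to the norm $\|\cdot\|_{H^p_{+1}}$ if $1\le p<\infty$, and with respect to the metric $d(f,g)=\sup_{y>0}\int_{-\infty}^\infty|f(x+iy)-g(x+iy)|^p\,dx$ if $0<p<1$. *)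

theory Defs
  imports "HOL-Analysis.Analysis" "HOL-Computational_Algebra.Polynomial"
begin

definition upper_half_plane :: "complex set" where
  "upper_half_plane = {z. 0 < Im z}"

text \<open>The power \<open>a\<^sup>r\<close> of an extended nonnegative real, intended for \<open>r > 0\<close>
  (so that the power of infinity is infinity).\<close>

definition ennreal_powr :: "ennreal \<Rightarrow> real \<Rightarrow> ennreal" where
  "ennreal_powr a r = (if a = top then top else ennreal (enn2real a powr r))"

definition line_integral_powr :: "real \<Rightarrow> (complex \<Rightarrow> complex) \<Rightarrow> real \<Rightarrow> ennreal" where
  "line_integral_powr p f y = (\<integral>\<^sup>+x. ennreal (cmod (f (Complex x y)) powr p) \<partial>lborel)"

definition hardy_norm :: "real \<Rightarrow> (complex \<Rightarrow> complex) \<Rightarrow> ennreal" where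
  "hardy_norm p f = (SUP y\<in>{0<..}. ennreal_powr (line_integral_powr p f y) (1 / p))"

text \<open>Elements of the Hardy space are represented by total functions on the complex numbers;
  only their values on the upper half plane matter, here and in all notions below.\<close>

definition hardy_space :: "real \<Rightarrow> (complex \<Rightarrow> complex) set" where
  "hardy_space p = {f. f holomorphic_on upper_half_plane \<and> hardy_norm p f < top}"

definition hardy_dist :: "real \<Rightarrow> (complex \<Rightarrow> complex) \<Rightarrow> (complex \<Rightarrow> complex) \<Rightarrow> ennreal" where
  "hardy_dist p f g =
     (if 1 \<le> p then hardy_norm p (\<lambda>z. f z - g z)
      else (SUP y\<in>{0<..}. line_integral_powr p (\<lambda>z. f z - g z) y))"

definition dense_in_hardy_space :: "real \<Rightarrow> (complex \<Rightarrow> complex) set \<Rightarrow> bool" where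
  "dense_in_hardy_space p S \<longleftrightarrow>
     S \<subseteq> hardy_space p \<and>
     (\<forall>f\<in>hardy_space p. \<forall>\<epsilon>::real. 0 < \<epsilon> \<longrightarrow> (\<exists>g\<in>S. hardy_dist p f g < ennreal \<epsilon>))"

definition rational_class :: "nat \<Rightarrow> (complex \<Rightarrow> complex) set" where
  "rational_class N =
     {f. \<exists>P :: complex poly. f = (\<lambda>z. (z + \<i>) powi (- int N - 1) * poly P (inverse (z + \<i>)))}"

end

theory Submission
  imports Defs "HOL-Complex_Analysis.Conformal_Mappings"
begin

text \<open>
The proof rests on one property of the integrals of the \<open>p\<close>-th power of the modulus over horizontal
lines: as long as they are bounded, they decrease with the height of the line
(\<open>line_integral_antimono\<close>). It comes from the sub-mean value property of powers of the modulus of a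
holomorphic function, which for all exponents \<open>p > 0\<close> at once follows from the approximation of
continuous functions on the circle by real parts of polynomials (\<open>powr_norm_subharmonic_disc\<close>).

For functions that are continuous up to the real line and decay like a large enough negative power of
\<open>z + \<i>\<close>, density is elementary: in the unit disc they become functions of the disc algebra, and
polynomials in \<open>w = (z - \<i>) / (z + \<i>)\<close> are polynomials in \<open>inverse (z + \<i>)\<close>
(\<open>rational_class_approx_of_decay\<close>). A function of the Hardy space is brought to this form by an upward
translation and a multiplication by a bounded factor that decays at infinity
(\<open>line_integral_cutoff_le\<close>).

The crucial point is that small upward translations change \<open>f\<close> only little, uniformly over all lines
(\<open>line_integral_translation_small\<close>), also for \<open>p \<le> 1\<close>, where uniform convexity is not at hand.
This, too, follows from monotonicity. Let \<open>u\<close> and \<open>v\<close> be the values of \<open>f\<close> above a point of the real line, at two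
small heights. The functions \<open>u * v\<close> and \<open>(u + v) / 2\<close> are again restrictions of holomorphic functions,
so the integrals of their moduli, to the powers \<open>p / 2\<close> and \<open>p\<close>, are at least what they are further up;
there \<open>u\<close> and \<open>v\<close> nearly coincide, and both integrals are nearly the supremum \<open>S\<close> of those of \<open>f\<close>. On
the other hand the moduli of \<open>u\<close> and \<open>v\<close> to the power \<open>p\<close> have integrals at most \<open>S\<close>. So equality nearly
holds in two inequalities: that of the arithmetic and geometric mean, which forces equal moduli, and
the triangle inequality for \<open>u + v\<close>, which forces equal arguments. The elementary inequality
\<open>powr_norm_diff_le_gaps\<close> makes this quantitative.
\<close>

section \<open>The sub-mean value property of powers of the modulus\<close>

text \<open>On the unit circle \<open>cnj w\<close> is the inverse of \<open>w\<close>, so \<open>A * cnj B\<close> is a Laurent polynomial there, and the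
real part of a negative power of \<open>w\<close> is that of the conjugate positive power. This is what closes
the real parts of polynomials under multiplication, as the Stone--Weierstrass theorem requires.\<close>

lemma Re_poly_mult_cnj_poly_on_circle:
  fixes A B :: "complex poly"
  shows "\<exists>C. \<forall>w. cmod w = 1 \<longrightarrow> Re (poly A w * cnj (poly B w)) = Re (poly C w)"
proof (induction A B rule: poly_induct2)
  case 0
  show ?case by (rule exI[of _ 0]) simp
next
  case (pCons a A b B)
  then obtain C where C: "\<And>w. cmod w = 1 \<Longrightarrow> Re (poly A w * cnj (poly B w)) = Re (poly C w)"
    by blast
  define D where "D = C + [:a * cnj b:] + smult (cnj a) (pCons 0 B) + smult (cnj b) (pCons 0 A)"
  have "Re (poly (pCons a A) w * cnj (poly (pCons b B) w)) = Re (poly D w)" if w: "cmod w = 1" for w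
  proof -
    have ww: "w * cnj w = 1"
      using w by (simp add: complex_norm_square[symmetric])
    have "poly (pCons a A) w * cnj (poly (pCons b B) w) =
        a * cnj b + cnj (cnj a * (w * poly B w)) + cnj b * (w * poly A w)
          + (w * cnj w) * (poly A w * cnj (poly B w))"
      by (simp add: algebra_simps)
    also have "Re \<dots> = Re (poly D w)"
      unfolding ww using C[OF w] unfolding D_def
      by (simp del: complex_cnj_mult add: algebra_simps)
    finally show ?thesis .
  qed
  then show ?case by blast
qed

lemma continuous_on_circle_approx_Re_poly:
  fixes \<phi> :: "complex \<Rightarrow> real"
  assumes "continuous_on (sphere 0 1) \<phi>" and "0 < e"
  obtains Q :: "complex poly" where "\<And>w. cmod w = 1 \<Longrightarrow> \<bar>\<phi> w - Re (poly Q w)\<bar> < e"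
proof -
  define trig where
    "trig g \<longleftrightarrow> (\<exists>Q. \<forall>w\<in>sphere 0 1. g w = Re (poly Q w))" for g :: "complex \<Rightarrow> real"
  have "\<exists>g. trig g \<and> (\<forall>w\<in>sphere 0 1. \<bar>\<phi> w - g w\<bar> < e)"
  proof (rule Stone_Weierstrass_HOL[where P = trig])
    show "compact (sphere (0::complex) 1)" by simp
    show "trig (\<lambda>x. c)" for c
      unfolding trig_def by (rule exI[of _ "[:of_real c:]"]) simp
    show "continuous_on (sphere 0 1) g" if tg: "trig g" for g
    proof -
      obtain Q where "\<forall>w\<in>sphere 0 1. g w = Re (poly Q w)" using tg unfolding trig_def by blast
      moreover have "continuous_on (sphere 0 1) (\<lambda>w. Re (poly Q w))"
        by (intro continuous_intros)
      ultimately show ?thesis by (metis (mono_tags, lifting) continuous_on_cong)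
    qed
    show "trig (\<lambda>x. f x + g x)" if fg: "trig f \<and> trig g" for f g
    proof -
      obtain A B where "\<forall>w\<in>sphere 0 1. f w = Re (poly A w)" "\<forall>w\<in>sphere 0 1. g w = Re (poly B w)"
        using fg unfolding trig_def by blast
      then show ?thesis unfolding trig_def by (intro exI[of _ "A + B"]) simp
    qed
    show "trig (\<lambda>x. f x * g x)" if fg: "trig f \<and> trig g" for f g
    proof -
      obtain A B where AB: "\<forall>w\<in>sphere 0 1. f w = Re (poly A w)" "\<forall>w\<in>sphere 0 1. g w = Re (poly B w)"
        using fg unfolding trig_def by blast
      obtain C where C: "\<And>w. cmod w = 1 \<Longrightarrow> Re (poly A w * cnj (poly B w)) = Re (poly C w)"
        using Re_poly_mult_cnj_poly_on_circle by blast
      have "Re (poly A w) * Re (poly B w) = Re (poly (smult (1/2) (A * B + C)) w)"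
        if "cmod w = 1" for w
        using C[OF that] by (simp add: field_simps)
      then show ?thesis unfolding trig_def using AB
        by (intro exI[of _ "smult (1/2) (A * B + C)"]) (simp del: poly_smult)
    qed
    show "\<exists>f. trig f \<and> f x \<noteq> f y" if xy: "x \<in> sphere 0 1 \<and> y \<in> sphere 0 1 \<and> x \<noteq> y" for x y
    proof -
      have "trig Re" unfolding trig_def by (rule exI[of _ "[:0, 1:]"]) simp
      moreover have "trig Im" unfolding trig_def by (rule exI[of _ "[:0, -\<i>:]"]) simp
      ultimately show ?thesis using xy complex_eq_iff by blast
    qed
  qed (use assms in auto)
  then show ?thesis using that unfolding trig_def by (metis mem_sphere_0)
qed

lemma integral_entire_over_circle:
  fixes K :: "complex \<Rightarrow> complex"
  assumes "K holomorphic_on cball 0 1"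
  shows "((\<lambda>t. K (cis t)) has_integral 2 * pi * K 0) {0..2 * pi}"
proof -
  have "((\<lambda>u. K u / (u - 0)) has_contour_integral (2 * of_real pi * \<i> * K 0)) (circlepath 0 1)"
    by (rule Cauchy_integral_circlepath_simple) (use assms in auto)
  then have "((\<lambda>t. K (cis t) * \<i>) has_integral 2 * of_real pi * \<i> * K 0) {0..2 * pi}"
    unfolding circlepath_def by (subst (asm) has_contour_integral_part_circlepath_iff) auto
  from has_integral_mult_left[OF this, of "-\<i>"] show ?thesis
    by (simp add: algebra_simps)
qed

lemma continuous_on_cis_circle:
  assumes "continuous_on (sphere 0 1) g"
  shows "continuous_on S (\<lambda>t. g (cis t))"
  by (rule continuous_on_compose2[OF assms]) (auto intro!: continuous_intros)

text \<open>The reason is that every continuous positive function on the circle is, up to a factor close to \<open>1\<close>,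
the modulus of \<open>exp \<circ> Q\<close> for a polynomial \<open>Q\<close>. Choose it as a tight majorant \<open>K\<close> of the \<open>q\<close>-th power of
the modulus of \<open>G\<close>. The maximum principle, applied to \<open>G\<close> divided by the \<open>q\<close>-th root of \<open>K\<close>, carries the
majorization to the centre, and the mean value property of the zero-free entire function \<open>K\<close>
evaluates its value at the centre.\<close>

lemma powr_norm_subharmonic_disc:
  fixes G :: "complex \<Rightarrow> complex"
  assumes cont: "continuous_on (cball 0 1) G" and hol: "G holomorphic_on ball 0 1" and q: "0 < q"
  shows "2 * pi * cmod (G 0) powr q \<le> integral {0..2 * pi} (\<lambda>t. cmod (G (cis t)) powr q)"
proof -
  define I where "I = integral {0..2 * pi} (\<lambda>t. cmod (G (cis t)) powr q)"
  have contS: "continuous_on (sphere 0 1) (\<lambda>w. cmod (G w) powr q)"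
    using cont by (intro continuous_intros continuous_on_subset[OF cont] continuous_on_powr')
       (use q in auto)
  have int: "(\<lambda>t. cmod (G (cis t)) powr q) integrable_on {0..2 * pi}"
    by (intro integrable_continuous_interval continuous_on_cis_circle[OF contS])
  have approx: "2 * pi * cmod (G 0) powr q \<le> exp (2 * \<eta>) * (I + 2 * pi * \<eta>)" if \<eta>: "0 < \<eta>" for \<eta>
  proof -
    obtain Q where Q: "\<And>w. cmod w = 1 \<Longrightarrow> \<bar>ln (cmod (G w) powr q + \<eta>) - Re (poly Q w)\<bar> < \<eta>"
    proof (rule continuous_on_circle_approx_Re_poly)
      have "cmod (G w) powr q + \<eta> \<noteq> 0" for w
        using \<eta> by (metis add_nonneg_pos less_irrefl powr_ge_zero)
      then show "continuous_on (sphere 0 1) (\<lambda>w. ln (cmod (G w) powr q + \<eta>))"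
        by (intro continuous_intros contS) auto
    qed (use \<eta> in auto)
    define K where "K w = exp (poly Q w + \<eta>)" for w
    have K_hol: "K holomorphic_on S" for S
      unfolding K_def by (intro holomorphic_intros)
    have pos: "cmod (G w) powr q + \<eta> > 0" for w
      using \<eta> by (simp add: add_nonneg_pos)
    have K_lower: "cmod (G w) powr q + \<eta> \<le> cmod (K w)" if "cmod w = 1" for w
    proof -
      have "ln (cmod (G w) powr q + \<eta>) \<le> Re (poly Q w) + \<eta>" using Q[OF that] by linarith
      then have "exp (ln (cmod (G w) powr q + \<eta>)) \<le> exp (Re (poly Q w) + \<eta>)" by simp
      then show ?thesis using pos[of w] by (simp add: K_def)
    qed
    have K_upper: "cmod (K w) \<le> exp (2 * \<eta>) * (cmod (G w) powr q + \<eta>)" if "cmod w = 1" for w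
    proof -
      have "Re (poly Q w) + \<eta> \<le> 2 * \<eta> + ln (cmod (G w) powr q + \<eta>)" using Q[OF that] by linarith
      then have "exp (Re (poly Q w) + \<eta>) \<le> exp (2 * \<eta> + ln (cmod (G w) powr q + \<eta>))" by simp
      also have "\<dots> = exp (2 * \<eta>) * (cmod (G w) powr q + \<eta>)"
        using pos[of w] by (simp add: exp_add)
      finally show ?thesis by (simp add: K_def)
    qed
    define H where "H w = G w * exp (- (poly Q w + \<eta>) / q)" for w
    have norm_H: "cmod (H w) powr q = cmod (G w) powr q / cmod (K w)" for w
    proof -
      have "cmod (H w) = cmod (G w) * exp (- (Re (poly Q w) + \<eta>) / q)"
        by (simp add: H_def norm_mult)
      then have "cmod (H w) powr q = cmod (G w) powr q * exp (- (Re (poly Q w) + \<eta>))"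
        using q by (simp add: powr_mult exp_powr_real)
      also have "exp (- (Re (poly Q w) + \<eta>)) = inverse (cmod (K w))"
        unfolding exp_minus by (simp add: K_def)
      finally show ?thesis by (simp add: divide_inverse)
    qed
    have "cmod (H 0) \<le> 1"
    proof (rule maximum_modulus_frontier[of H "cball 0 1"])
      show "H holomorphic_on interior (cball 0 1)"
        unfolding H_def using hol q by (auto intro!: holomorphic_intros)
      show "continuous_on (closure (cball 0 1)) H"
        unfolding H_def using cont q by (auto intro!: continuous_intros)
      show "cmod (H w) \<le> 1" if "w \<in> frontier (cball 0 1)" for w
      proof (rule ccontr)
        assume "\<not> cmod (H w) \<le> 1"
        then have "cmod (H w) powr q > 1" using q by (simp add: gr_one_powr)
        moreover have "cmod (G w) powr q / cmod (K w) \<le> 1"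
          using K_lower[of w] that \<eta> by (simp add: divide_le_eq K_def)
        ultimately show False by (simp add: norm_H)
      qed
    qed auto
    then have "cmod (H 0) powr q \<le> 1" using q by (simp add: powr_le_one_le powr_le1)
    then have "cmod (G 0) powr q \<le> cmod (K 0)"
      by (simp add: norm_H divide_le_eq K_def)
    moreover have "2 * pi * cmod (K 0) \<le> exp (2 * \<eta>) * (I + 2 * pi * \<eta>)"
    proof -
      have hK: "((\<lambda>t. K (cis t)) has_integral 2 * pi * K 0) {0..2 * pi}"
        by (rule integral_entire_over_circle[OF K_hol])
      have hI: "((\<lambda>t. exp (2 * \<eta>) * (cmod (G (cis t)) powr q + \<eta>)) has_integral
              exp (2 * \<eta>) * (I + (2 * pi - 0) *\<^sub>R \<eta>)) {0..2 * pi}"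
        unfolding I_def
        by (intro has_integral_mult_right has_integral_add integrable_integral[OF int])
           (use has_integral_const_real[of \<eta> 0 "2 * pi"] in auto)
      have "cmod (2 * pi * K 0) \<le> exp (2 * \<eta>) * (I + (2 * pi - 0) *\<^sub>R \<eta>)"
        using integral_norm_bound_integral[OF has_integral_integrable[OF hK] has_integral_integrable[OF hI]]
          K_upper unfolding integral_unique[OF hK] integral_unique[OF hI] by simp
      then show ?thesis by (simp add: norm_mult)
    qed
    moreover have "2 * pi * cmod (G 0) powr q \<le> 2 * pi * cmod (K 0)"
      using calculation(1) by (intro mult_left_mono) auto
    ultimately show ?thesis by linarith
  qed
  have "((\<lambda>\<eta>. exp (2 * \<eta>) * (I + 2 * pi * \<eta>)) \<longlongrightarrow> exp (2 * 0) * (I + 2 * pi * 0)) (at_right 0)"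
    by (intro tendsto_intros)
  then have "2 * pi * cmod (G 0) powr q \<le> exp (2 * 0) * (I + 2 * pi * 0)"
    by (rule tendsto_lowerbound) (auto simp: eventually_at_right_less intro: approx
          eventually_mono[OF eventually_at_right_less[of 0]])
  then show ?thesis by (simp add: I_def)
qed

section \<open>Monotonicity of integrals over horizontal lines\<close>

lemma open_upper_half_plane: "open upper_half_plane"
  unfolding upper_half_plane_def by (rule open_halfspace_Im_gt)

lemma continuous_on_horizontal_powr:
  assumes "continuous_on upper_half_plane F" and "0 < y" and "0 < q"
  shows "continuous_on S (\<lambda>x. cmod (F (Complex x y)) powr q)"
proof (intro continuous_on_powr' continuous_intros)
  show "continuous_on S (\<lambda>x. F (Complex x y))"
    by (rule continuous_on_compose2[OF assms(1)])
       (use assms in \<open>auto simp: upper_half_plane_def Complex_eq intro!: continuous_intros\<close>)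
qed (use assms in auto)

lemma borel_measurable_horizontal_powr:
  assumes "continuous_on upper_half_plane F" and "0 < y" and "0 < q"
  shows "(\<lambda>x. cmod (F (Complex x y)) powr q) \<in> borel_measurable borel"
  using continuous_on_horizontal_powr[OF assms, of UNIV] by (rule borel_measurable_continuous_onI)

text \<open>Integrals over segments are finite and continuous in the base point, before anything is known about
the growth of \<open>F\<close>; this lemma and the next translate between them and integrals over whole lines.\<close>

lemma integral_segment_le_line_integral:
  assumes F: "continuous_on upper_half_plane F" and z: "0 < Im z" and q: "0 < q"
  shows "ennreal (integral {a..b} (\<lambda>s. cmod (F (z + of_real s)) powr q)) \<le> line_integral_powr q F (Im z)"
proof -
  have eq: "z + of_real s = Complex (Re z + 1 * s) (Im z)" for s
    by (simp add: complex_eq_iff)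
  have "continuous_on {a..b} (\<lambda>s. cmod (F (Complex (Re z + 1 * s) (Im z))) powr q)"
    using continuous_on_horizontal_powr[OF F z q, of UNIV]
    by (rule continuous_on_compose2) (auto intro!: continuous_intros)
  then have "((\<lambda>s. cmod (F (Complex (Re z + 1 * s) (Im z))) powr q) has_integral
      integral {a..b} (\<lambda>s. cmod (F (z + of_real s)) powr q)) {a..b}"
    unfolding eq by (intro integrable_integral integrable_continuous_interval)
  from nn_integral_has_integral_lebesgue[OF _ this]
  have "ennreal (integral {a..b} (\<lambda>s. cmod (F (z + of_real s)) powr q)) =
      (\<integral>\<^sup>+s. ennreal (indicator {a..b} s * cmod (F (Complex (Re z + 1 * s) (Im z))) powr q) \<partial>lborel)"
    by simp
  also have "\<dots> \<le> (\<integral>\<^sup>+s. ennreal (cmod (F (Complex (Re z + 1 * s) (Im z))) powr q) \<partial>lborel)"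
    by (intro nn_integral_mono) (auto simp: indicator_def)
  also have "\<dots> = line_integral_powr q F (Im z)"
    unfolding line_integral_powr_def
    using nn_integral_real_affine[of "\<lambda>x. ennreal (cmod (F (Complex x (Im z))) powr q)" 1 "Re z"]
      borel_measurable_horizontal_powr[OF F z q] by simp
  finally show ?thesis .
qed

lemma line_integral_leI_segments:
  assumes F: "continuous_on upper_half_plane F" and y: "0 < y" and q: "0 < q"
    and le: "\<And>n::nat. ennreal (integral {-real n..real n} (\<lambda>s. cmod (F (\<i> * y + of_real s)) powr q)) \<le> B"
  shows "line_integral_powr q F y \<le> B"
proof -
  define g where "g x = cmod (F (Complex x y)) powr q" for x
  have [measurable]: "g \<in> borel_measurable borel"
    using borel_measurable_horizontal_powr[OF F y q] by (simp add: g_def[abs_def])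
  have eq: "\<i> * y + of_real s = Complex s y" for s
    by (simp add: complex_eq_iff)
  have seg: "(\<integral>\<^sup>+x. ennreal (g x) * indicator {-real n..real n} x \<partial>lborel) \<le> B" for n
  proof -
    have "(g has_integral integral {-real n..real n} g) {-real n..real n}"
      unfolding g_def[abs_def]
      by (intro integrable_integral integrable_continuous_interval continuous_on_horizontal_powr F y q)
    from nn_integral_has_integral_lebesgue'[OF _ this] show ?thesis
      using le[of n] by (simp add: g_def[abs_def] eq)
  qed
  have sup: "(SUP n. ennreal (g x) * indicator {-real n..real n} x) = ennreal (g x)" for x
  proof (rule antisym)
    obtain n where "\<bar>x\<bar> \<le> real n" using real_arch_simple by blast
    then have "ennreal (g x) = ennreal (g x) * indicator {-real n..real n} x"
      by (auto simp: indicator_def)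
    then show "ennreal (g x) \<le> (SUP n. ennreal (g x) * indicator {-real n..real n} x)"
      by (intro SUP_upper2[of n]) auto
  qed (auto intro!: SUP_least simp: indicator_def)
  have "line_integral_powr q F y = (\<integral>\<^sup>+x. (SUP n. ennreal (g x) * indicator {-real n..real n} x) \<partial>lborel)"
    unfolding sup by (simp add: line_integral_powr_def g_def)
  also have "\<dots> = (SUP n. \<integral>\<^sup>+x. ennreal (g x) * indicator {-real n..real n} x \<partial>lborel)"
    by (intro nn_integral_monotone_convergence_SUP)
       (auto simp: incseq_def le_fun_def indicator_def)
  also have "\<dots> \<le> B"
    by (intro SUP_least seg)
  finally show ?thesis .
qed

text \<open>The imaginary part of \<open>\<i> * (1 + w) / (1 - w)\<close>, the Cayley map of the unit disc onto the upper
half plane.\<close>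

lemma Re_Cayley:
  assumes "w \<noteq> 1"
  shows "Re ((1 + w) / (1 - w)) = (1 - (cmod w)\<^sup>2) / (cmod (1 - w))\<^sup>2"
proof -
  have "(1 + w) * cnj (1 - w) = 1 - w * cnj w + (w - cnj w)"
    by (simp add: algebra_simps)
  then have "Re ((1 + w) * cnj (1 - w)) = 1 - (cmod w)\<^sup>2"
    by (simp add: complex_norm_square[symmetric] del: of_real_power complex_cnj_diff)
  then show ?thesis
    by (subst complex_div_cnj) (simp add: Re_divide_of_real)
qed

text \<open>The integral \<open>\<Phi> R z\<close> of the \<open>q\<close>-th power of the modulus of \<open>F\<close> over a segment of length \<open>2 * R\<close> centred at \<open>z\<close>
is continuous, bounded by \<open>A\<close>, and inherits the sub-mean value property of the integrand. Map the
unit disc to the half plane above height \<open>h\<close> so that the centre goes to \<open>\<i> * y\<close>. On the circles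
of radius \<open>r < 1\<close> the sub-mean value property holds; boundedness of \<open>\<Phi> R\<close> permits the passage to
\<open>r = 1\<close>, where all points except one lie at height \<open>h\<close>. Averaging over segments is what avoids any
prior bound for \<open>F\<close> itself.\<close>

lemma line_integral_antimono:
  assumes hol: "F holomorphic_on upper_half_plane" and q: "0 < q"
    and A: "\<And>y. 0 < y \<Longrightarrow> line_integral_powr q F y \<le> A" "A < top"
    and h: "0 < h" "h \<le> y"
  shows "line_integral_powr q F y \<le> line_integral_powr q F h"
proof (cases "h = y")
  case False
  then have hy: "0 < h" "h < y" using h by auto
  have contF: "continuous_on upper_half_plane F"
    using hol by (rule holomorphic_on_imp_continuous_on)
  define \<Phi> where "\<Phi> R z = integral {-R..R} (\<lambda>s. cmod (F (z + of_real s)) powr q)" for R z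
  define a where "a = enn2real A"
  define b where "b = enn2real (line_integral_powr q F h)"
  have Aa: "A = ennreal a" and a0: "0 \<le> a" using A(2) by (auto simp: a_def)
  have fin_h: "line_integral_powr q F h < top" using A hy by (meson le_less_trans)
  then have hb: "line_integral_powr q F h = ennreal b" and b0: "0 \<le> b" by (auto simp: b_def)
  have \<Phi>_nonneg: "0 \<le> \<Phi> R z" for R z
    unfolding \<Phi>_def by (cases "(\<lambda>s. cmod (F (z + of_real s)) powr q) integrable_on {-R..R}")
      (auto intro: integral_nonneg simp: not_integrable_integral)
  have \<Phi>_le: "\<Phi> R z \<le> c" if "0 < Im z" "line_integral_powr q F (Im z) \<le> ennreal c" "0 \<le> c" for R z c
    using order_trans[OF integral_segment_le_line_integral[OF contF that(1) q] that(2)] that(3)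
    by (simp add: \<Phi>_def)
  have cont2: "continuous_on (upper_half_plane \<times> cbox (-R) R) (\<lambda>(z, s). cmod (F (z + of_real s)) powr q)" for R
    unfolding case_prod_beta
    by (intro continuous_on_powr' continuous_intros continuous_on_compose2[OF contF])
       (use q in \<open>auto simp: upper_half_plane_def\<close>)
  have \<Phi>_cont: "continuous_on upper_half_plane (\<Phi> R)" for R
    using integral_continuous_on_param[OF cont2, of R] by (simp add: \<Phi>_def[abs_def])
  define \<zeta> where "\<zeta> w = \<i> * h + \<i> * (y - h) * ((1 + w) / (1 - w))" for w :: complex
  have Im_\<zeta>: "Im (\<zeta> w) = h + (y - h) * ((1 - (cmod w)\<^sup>2) / (cmod (1 - w))\<^sup>2)" if "w \<noteq> 1" for w
  proof -
    have "Im (\<i> * h + \<i> * (y - h) * u) = h + (y - h) * Re u" for u :: complex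
      by simp
    then show ?thesis using Re_Cayley[OF that] by (simp only: \<zeta>_def)
  qed
  have \<zeta>_uhp: "\<zeta> w \<in> upper_half_plane" if "cmod w \<le> 1" "w \<noteq> 1" for w
  proof -
    have "0 \<le> (1 - (cmod w)\<^sup>2) / (cmod (1 - w))\<^sup>2"
      using that by (intro divide_nonneg_nonneg) (auto simp: power_le_one)
    then have "0 \<le> (y - h) * ((1 - (cmod w)\<^sup>2) / (cmod (1 - w))\<^sup>2)"
      using hy by (intro mult_nonneg_nonneg) auto
    then show ?thesis
      using hy(1) unfolding upper_half_plane_def mem_Collect_eq Im_\<zeta>[OF that(2)] by linarith
  qed
  have mean: "2 * pi * \<Phi> R (\<i> * y) \<le> integral {0..2 * pi} (\<lambda>t. \<Phi> R (\<zeta> (r * cis t)))"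
    if r: "0 \<le> r" "r < 1" for R r :: real
  proof -
    have norm_r: "cmod (r * w) < 1" if "cmod w \<le> 1" for w :: complex
      using r(2) mult_left_mono[OF that r(1)] r(1) by (simp add: norm_mult)
    have ne: "r * w \<noteq> 1" if "cmod w \<le> 1" for w :: complex
      using norm_r[OF that] by force
    have uhp: "\<zeta> (r * w) + of_real s \<in> upper_half_plane" if "cmod w \<le> 1" for w :: complex and s :: real
      using \<zeta>_uhp[of "r * w"] norm_r[OF that] ne[OF that] by (auto simp: upper_half_plane_def)
    \<comment> \<open>The same disc, shifted horizontally by \<open>s\<close>; integrating over \<open>s\<close> then gives the bound for segments.\<close>
    have point: "2 * pi * cmod (F (\<i> * y + of_real s)) powr q \<le>
        integral {0..2 * pi} (\<lambda>t. cmod (F (\<zeta> (r * cis t) + of_real s)) powr q)" for s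
    proof -
      have hol': "(\<lambda>w. F (\<zeta> (r * w) + of_real s)) holomorphic_on cball 0 1"
      proof -
        have "(\<lambda>w. \<zeta> (r * w) + of_real s) holomorphic_on cball 0 1"
          unfolding \<zeta>_def using ne by (auto intro!: holomorphic_intros)
        moreover have "(\<lambda>w::complex. \<zeta> (r * w) + of_real s) ` cball 0 1 \<subseteq> upper_half_plane"
          using uhp by auto
        ultimately show ?thesis
          using holomorphic_on_compose_gen[OF _ hol] by (simp add: o_def)
      qed
      have "2 * pi * cmod (F (\<zeta> (of_real r * 0) + of_real s)) powr q \<le>
        integral {0..2 * pi} (\<lambda>t. cmod (F (\<zeta> (r * cis t) + of_real s)) powr q)"
        by (rule powr_norm_subharmonic_disc[OF holomorphic_on_imp_continuous_on[OF hol']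
              holomorphic_on_subset[OF hol' ball_subset_cball] q])
      moreover have "\<zeta> (of_real r * 0) = \<i> * y" by (simp add: \<zeta>_def algebra_simps)
      ultimately show ?thesis by simp
    qed
    have cont: "continuous_on (cbox (-R, 0) (R, 2 * pi)) (\<lambda>(s, t). cmod (F (\<zeta> (r * cis t) + of_real s)) powr q)"
    proof -
      have "continuous_on (cbox (-R, 0) (R, 2 * pi)) (\<lambda>p. \<zeta> (r * cis (snd p)) + of_real (fst p))"
        unfolding \<zeta>_def using ne by (auto intro!: continuous_intros)
      then have "continuous_on (cbox (-R, 0) (R, 2 * pi)) (\<lambda>p. F (\<zeta> (r * cis (snd p)) + of_real (fst p)))"
        by (rule continuous_on_compose2[OF contF]) (use uhp in auto)
      then show ?thesis
        unfolding case_prod_beta by (intro continuous_on_powr' continuous_intros) (use q in auto)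
    qed
    have conti: "continuous_on {-R..R} (\<lambda>s. cmod (F (\<i> * y + of_real s)) powr q)"
      by (intro continuous_on_powr' continuous_intros continuous_on_compose2[OF contF])
         (use q hy in \<open>auto simp: upper_half_plane_def\<close>)
    have contj: "continuous_on (cbox (-R) R) (\<lambda>s. integral (cbox 0 (2 * pi)) (\<lambda>t. cmod (F (\<zeta> (r * cis t) + of_real s)) powr q))"
      by (rule integral_continuous_on_param) (use cont in \<open>simp add: cbox_Pair_eq\<close>)
    have "2 * pi * \<Phi> R (\<i> * y) = integral {-R..R} (\<lambda>s. 2 * pi * cmod (F (\<i> * y + of_real s)) powr q)"
      by (simp add: \<Phi>_def)
    also have "\<dots> \<le> integral {-R..R} (\<lambda>s. integral {0..2 * pi} (\<lambda>t. cmod (F (\<zeta> (r * cis t) + of_real s)) powr q))"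
      by (intro integral_le point integrable_continuous_interval continuous_intros conti)
         (use contj in auto)
    also have "\<dots> = integral {0..2 * pi} (\<lambda>t. \<Phi> R (\<zeta> (r * cis t)))"
      using integral_swap_continuous[OF cont] by (simp add: \<Phi>_def)
    finally show ?thesis .
  qed
  have \<Phi>_le_b: "\<Phi> R (\<i> * y) \<le> b" for R
  proof -
    \<comment> \<open>Radii increasing to \<open>1\<close>; the integrals are taken over the open interval because \<open>cis t = 1\<close>,
      at its two ends, is the point of the circle that \<open>\<zeta>\<close> sends to infinity.\<close>
    define r where "r n = real n / real (Suc n)" for n
    have r: "0 \<le> r n" "r n < 1" for n by (auto simp: r_def)
    have r_lim: "r \<longlonglongrightarrow> 1" unfolding r_def by (rule LIMSEQ_n_over_Suc_n)
    have cis_ne: "cis t \<noteq> 1" if t: "t \<in> {0<..<2 * pi}" for t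
    proof
      assume "cis t = 1"
      then have "cos t = 1" by (simp add: complex_eq_iff)
      then obtain n :: int where n: "t = of_int n * 2 * pi" using cos_one_2pi_int by blast
      then have "0 < of_int n * (2 * pi)" "of_int n * (2 * pi) < 1 * (2 * pi)"
        using t by auto
      then have "0 < n" "n < 1"
        by (simp_all only: zero_less_mult_iff mult_less_cancel_right) auto
      then show False by simp
    qed
    have rn: "cmod (r n * cis t) < 1" for n t
      using r[of n] by (simp add: norm_mult)
    have uhp: "\<zeta> (r n * cis t) \<in> upper_half_plane" for n t
      using \<zeta>_uhp[of "r n * cis t"] rn[of n t] by force
    have "continuous_on {0..2 * pi} (\<lambda>t. \<Phi> R (\<zeta> (r n * cis t)))" for n
    proof (rule continuous_on_compose2[OF \<Phi>_cont])
      have "1 - r n * cis t \<noteq> 0" for t using rn[of n t] by force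
      then show "continuous_on {0..2 * pi} (\<lambda>t. \<zeta> (r n * cis t))"
        unfolding \<zeta>_def by (intro continuous_intros) auto
    qed (use uhp in auto)
    then have int: "(\<lambda>t. \<Phi> R (\<zeta> (r n * cis t))) integrable_on {0<..<2 * pi}" for n
      by (simp add: integrable_continuous_interval integrable_on_open_interval_real)
    have conv: "(\<lambda>n. \<Phi> R (\<zeta> (r n * cis t))) \<longlonglongrightarrow> \<Phi> R (\<zeta> (cis t))" if t: "t \<in> {0<..<2 * pi}" for t
    proof (rule continuous_on_tendsto_compose[OF \<Phi>_cont])
      have "(\<lambda>n. \<zeta> (r n * cis t)) \<longlonglongrightarrow> \<zeta> (of_real 1 * cis t)"
        unfolding \<zeta>_def using cis_ne[OF t] by (intro tendsto_intros r_lim) auto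
      then show "(\<lambda>n. \<zeta> (r n * cis t)) \<longlonglongrightarrow> \<zeta> (cis t)" by simp
    qed (use uhp \<zeta>_uhp[of "cis t"] cis_ne[OF t] in auto)
    have bound: "norm (\<Phi> R (\<zeta> (r n * cis t))) \<le> a" for n t
      using \<Phi>_le[of "\<zeta> (r n * cis t)" a R] uhp[of n t] A(1) a0 \<Phi>_nonneg
      by (simp add: Aa upper_half_plane_def)
    note dc = dominated_convergence[OF int integrable_on_const bound conv]
    have lim: "(\<lambda>n. integral {0<..<2 * pi} (\<lambda>t. \<Phi> R (\<zeta> (r n * cis t)))) \<longlonglongrightarrow>
        integral {0<..<2 * pi} (\<lambda>t. \<Phi> R (\<zeta> (cis t)))"
      by (rule dc(2)) auto
    have "integral {0<..<2 * pi} (\<lambda>t. \<Phi> R (\<zeta> (cis t))) \<le> integral {0<..<2 * pi} (\<lambda>t. b)"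
    proof (rule integral_le)
      show "(\<lambda>t. \<Phi> R (\<zeta> (cis t))) integrable_on {0<..<2 * pi}" by (rule dc(1)) auto
      show "\<Phi> R (\<zeta> (cis t)) \<le> b" if t: "t \<in> {0<..<2 * pi}" for t
      proof -
        have "Im (\<zeta> (cis t)) = h" using Im_\<zeta>[OF cis_ne[OF t]] by simp
        then show ?thesis using \<Phi>_le[of "\<zeta> (cis t)" b R] hy hb b0 by simp
      qed
    qed (auto intro: integrable_on_const)
    also have "\<dots> = 2 * pi * b"
      by (simp flip: integral_open_interval_real)
    finally have "integral {0<..<2 * pi} (\<lambda>t. \<Phi> R (\<zeta> (cis t))) \<le> 2 * pi * b" .
    moreover have "2 * pi * \<Phi> R (\<i> * y) \<le> integral {0<..<2 * pi} (\<lambda>t. \<Phi> R (\<zeta> (cis t)))"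
      by (rule tendsto_lowerbound[OF lim])
         (use mean[OF r] in \<open>auto simp flip: integral_open_interval_real\<close>)
    ultimately have "2 * pi * \<Phi> R (\<i> * y) \<le> 2 * pi * b" by linarith
    then show ?thesis by simp
  qed
  show ?thesis
    unfolding hb
    by (rule line_integral_leI_segments[OF contF _ q])
       (use hy \<Phi>_le_b in \<open>auto simp: \<Phi>_def ennreal_leI\<close>)
qed simp

section \<open>A pointwise bound from the integrals over lines\<close>

lemma nn_integral_lborel_iterated:
  fixes g :: "real \<times> real \<Rightarrow> ennreal"
  assumes [measurable]: "g \<in> borel_measurable borel"
  shows "(\<integral>\<^sup>+p. g p \<partial>lborel) = (\<integral>\<^sup>+x. \<integral>\<^sup>+y. g (x, y) \<partial>lborel \<partial>lborel)"
    and "(\<integral>\<^sup>+p. g p \<partial>lborel) = (\<integral>\<^sup>+y. \<integral>\<^sup>+x. g (x, y) \<partial>lborel \<partial>lborel)"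
proof -
  have m: "g \<in> borel_measurable (lborel \<Otimes>\<^sub>M lborel)"
    by (simp add: lborel_prod)
  show 1: "(\<integral>\<^sup>+p. g p \<partial>lborel) = (\<integral>\<^sup>+x. \<integral>\<^sup>+y. g (x, y) \<partial>lborel \<partial>lborel)"
    using lborel.nn_integral_fst[OF m] by (simp add: lborel_prod)
  show "(\<integral>\<^sup>+p. g p \<partial>lborel) = (\<integral>\<^sup>+y. \<integral>\<^sup>+x. g (x, y) \<partial>lborel \<partial>lborel)"
    unfolding 1 by (rule lborel_pair.Fubini'[symmetric]) (use m in simp)
qed

text \<open>A rotation with \<open>c \<noteq> 0\<close> is a composition of two maps each of which changes one coordinate affinely,
with factors \<open>c\<close> and \<open>1 / c\<close>.\<close>

lemma nn_integral_rotation: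
  fixes g :: "real \<times> real \<Rightarrow> ennreal" and c \<sigma> :: real
  assumes g: "g \<in> borel_measurable borel" and cs: "c\<^sup>2 + \<sigma>\<^sup>2 = 1" and c: "c \<noteq> 0"
  shows "(\<integral>\<^sup>+p. g (c * fst p - \<sigma> * snd p, \<sigma> * fst p + c * snd p) \<partial>lborel) = (\<integral>\<^sup>+p. g p \<partial>lborel)"
proof -
  note [measurable] = g
  have meas: "(\<lambda>p. g (h p)) \<in> borel_measurable borel" if "continuous_on UNIV h"
    for h :: "'b::topological_space \<Rightarrow> real \<times> real"
    using borel_measurable_continuous_onI[OF that] by measurable
  let ?c = "ennreal \<bar>c\<bar>"
  have inner_s: "?c * (\<integral>\<^sup>+s. g (c * s - \<sigma> * t, \<sigma> * s + c * t) \<partial>lborel) = (\<integral>\<^sup>+x. g (x, (\<sigma> * x + t) / c) \<partial>lborel)" for t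
  proof -
    have "(\<sigma> * (- (\<sigma> * t) + c * s) + t) / c = \<sigma> * s + c * t" for s
    proof -
      have "\<sigma> * (- (\<sigma> * t) + c * s) + t = \<sigma> * c * s + (1 - \<sigma>\<^sup>2) * t"
        by (simp add: algebra_simps power2_eq_square)
      also have "1 - \<sigma>\<^sup>2 = c\<^sup>2" using cs by simp
      finally show ?thesis using c by (simp add: field_simps power2_eq_square)
    qed
    then have eq: "g (- (\<sigma> * t) + c * s, (\<sigma> * (- (\<sigma> * t) + c * s) + t) / c) = g (c * s - \<sigma> * t, \<sigma> * s + c * t)" for s
      by simp
    have "(\<lambda>x. g (x, (\<sigma> * x + t) / c)) \<in> borel_measurable borel"
      by (intro meas continuous_intros) (use c in auto)
    from nn_integral_real_affine[OF this c, of "- (\<sigma> * t)"] show ?thesis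
      unfolding eq by simp
  qed
  have inner_t: "(\<integral>\<^sup>+t. g (x, (\<sigma> * x + t) / c) \<partial>lborel) = ?c * (\<integral>\<^sup>+y. g (x, y) \<partial>lborel)" for x
  proof -
    have eq: "g (x, (\<sigma> * x + (- (\<sigma> * x) + c * y)) / c) = g (x, y)" for y
      using c by simp
    have "(\<lambda>t. g (x, (\<sigma> * x + t) / c)) \<in> borel_measurable borel"
      by (intro meas continuous_intros) (use c in auto)
    from nn_integral_real_affine[OF this c, of "- (\<sigma> * x)"] show ?thesis
      unfolding eq by simp
  qed
  have "?c * (\<integral>\<^sup>+p. g (c * fst p - \<sigma> * snd p, \<sigma> * fst p + c * snd p) \<partial>lborel)
      = ?c * (\<integral>\<^sup>+t. \<integral>\<^sup>+s. g (c * s - \<sigma> * t, \<sigma> * s + c * t) \<partial>lborel \<partial>lborel)"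
    by (subst nn_integral_lborel_iterated(2)) (auto intro!: meas continuous_intros)
  also have "\<dots> = (\<integral>\<^sup>+t. \<integral>\<^sup>+x. g (x, (\<sigma> * x + t) / c) \<partial>lborel \<partial>lborel)"
    unfolding inner_s[symmetric] by (intro nn_integral_cmult[symmetric]) measurable
  also have "\<dots> = (\<integral>\<^sup>+p. g (fst p, (\<sigma> * fst p + snd p) / c) \<partial>lborel)"
    by (subst nn_integral_lborel_iterated(2)) (use c in \<open>auto intro!: meas continuous_intros\<close>)
  also have "\<dots> = (\<integral>\<^sup>+x. ?c * (\<integral>\<^sup>+y. g (x, y) \<partial>lborel) \<partial>lborel)"
    by (subst nn_integral_lborel_iterated(1)) (use c inner_t in \<open>auto intro!: meas continuous_intros\<close>)
  also have "\<dots> = ?c * (\<integral>\<^sup>+p. g p \<partial>lborel)"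
    unfolding nn_integral_lborel_iterated(1)[OF g] by (rule nn_integral_cmult) measurable
  finally show ?thesis
    using c by (simp add: ennreal_mult_cancel_left)
qed

text \<open>This is the estimate of a subharmonic function by its area means. For every \<open>\<zeta>\<close> in a square around \<open>0\<close>, the value at \<open>z\<close> is at most the mean over the circle of
the values at \<open>z + cis t * \<zeta>\<close>. Integrate over the square and exchange the integrals: for
fixed \<open>t\<close> the rotated square lies in a horizontal strip, over which the integral is at most the
height of the strip times \<open>A\<close>.\<close>

lemma powr_norm_le_of_line_integral_bound:
  assumes hol: "F holomorphic_on upper_half_plane" and q: "0 < q"
    and A: "\<And>y. 0 < y \<Longrightarrow> line_integral_powr q F y \<le> A"
    and \<rho>: "0 < \<rho>" "2 * \<rho> < Im z"
  shows "ennreal (\<rho> * cmod (F z) powr q) \<le> A"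
proof -
  \<comment> \<open>Extension of \<open>F\<close> by \<open>0\<close>, to have a function that is measurable on the whole plane.\<close>
  define E where "E w = (if w \<in> upper_half_plane then F w else 0)" for w
  have [measurable]: "E \<in> borel_measurable borel"
    unfolding E_def
    by (rule borel_measurable_continuous_on_if)
       (use holomorphic_on_imp_continuous_on[OF hol] open_upper_half_plane in auto)
  define g where "g p = indicator {-2 * \<rho>..2 * \<rho>} (snd p) *
      ennreal (cmod (E (z + of_real (fst p) + \<i> * of_real (snd p))) powr q)" for p :: "real \<times> real"
  have g[measurable]: "g \<in> borel_measurable borel"
  proof -
    have [measurable]: "(\<lambda>p::real \<times> real. z + of_real (fst p) + \<i> * of_real (snd p)) \<in> borel_measurable borel"
      by (intro borel_measurable_continuous_onI continuous_intros)
    have [measurable]: "(snd :: real \<times> real \<Rightarrow> real) \<in> borel_measurable borel"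
      by (intro borel_measurable_continuous_onI continuous_intros)
    show ?thesis unfolding g_def[abs_def] by measurable
  qed
  define J where "J = (\<integral>\<^sup>+p. g p \<partial>lborel)"
  define X where "X = cmod (F z) powr q"
  define rot where "rot t p = (cos t * fst p - sin t * snd p, sin t * fst p + cos t * snd p)" for t and p :: "real \<times> real"
  define Q where "Q = {-\<rho>..\<rho>} \<times> {-\<rho>..\<rho>}"
  have point: "ennreal (2 * pi * X) * indicator Q p \<le>
      (\<integral>\<^sup>+t. indicator {0..2 * pi} t * g (rot t p) \<partial>lborel)" for p
  proof (cases "p \<in> Q")
    case True
    obtain s u where p: "p = (s, u)" by (cases p)
    have su: "\<bar>s\<bar> \<le> \<rho>" "\<bar>u\<bar> \<le> \<rho>" using True by (auto simp: p Q_def)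
    define G where "G w = F (z + w * Complex s u)" for w
    have small: "cmod (w * Complex s u) \<le> 2 * \<rho>" if "cmod w \<le> 1" for w
    proof -
      have "cmod (Complex s u) \<le> \<bar>s\<bar> + \<bar>u\<bar>" using cmod_le[of "Complex s u"] by simp
      then have "cmod w * cmod (Complex s u) \<le> 1 * (2 * \<rho>)"
        using that su by (intro mult_mono) auto
      then show ?thesis by (simp add: norm_mult)
    qed
    have uhp: "z + w * Complex s u \<in> upper_half_plane" if "cmod w \<le> 1" for w
      using small[OF that] abs_Im_le_cmod[of "w * Complex s u"] \<rho>
      by (simp add: upper_half_plane_def)
    have "(\<lambda>w. z + w * Complex s u) holomorphic_on cball 0 1"
      by (intro holomorphic_intros)
    moreover have "(\<lambda>w. z + w * Complex s u) ` cball 0 1 \<subseteq> upper_half_plane"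
      using uhp by auto
    ultimately have holG: "G holomorphic_on cball 0 1"
      using holomorphic_on_compose_gen[OF _ hol] by (simp add: o_def G_def[abs_def])
    have contG: "continuous_on (cball 0 1) G"
      by (rule holomorphic_on_imp_continuous_on[OF holG])
    have cont: "continuous_on {0..2 * pi} (\<lambda>t. cmod (G (cis t)) powr q)"
      by (intro continuous_on_powr' continuous_intros
            continuous_on_cis_circle continuous_on_subset[OF contG]) (use q in auto)
    have "2 * pi * X \<le> integral {0..2 * pi} (\<lambda>t. cmod (G (cis t)) powr q)"
      using powr_norm_subharmonic_disc[OF contG holomorphic_on_subset[OF holG ball_subset_cball] q]
      by (simp add: X_def G_def)
    also have "ennreal \<dots> = (\<integral>\<^sup>+t. ennreal (indicator {0..2 * pi} t * cmod (G (cis t)) powr q) \<partial>lborel)"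
      using nn_integral_has_integral_lebesgue[OF _ integrable_integral[OF integrable_continuous_interval[OF cont]]]
      by simp
    also have "\<dots> = (\<integral>\<^sup>+t. indicator {0..2 * pi} t * g (rot t p) \<partial>lborel)"
    proof (intro nn_integral_cong)
      fix t :: real
      have pt: "z + of_real (cos t * s - sin t * u) + \<i> * of_real (sin t * s + cos t * u) = z + cis t * Complex s u"
        by (simp add: complex_eq_iff)
      have "\<bar>sin t * s + cos t * u\<bar> \<le> 2 * \<rho>"
        using small[of "cis t"] abs_Im_le_cmod[of "cis t * Complex s u"] by simp
      then have "sin t * s + cos t * u \<in> {-2 * \<rho>..2 * \<rho>}" by auto
      then have "g (rot t p) = ennreal (cmod (G (cis t)) powr q)"
        using uhp[of "cis t"] unfolding g_def rot_def p fst_conv snd_conv pt by (simp add: E_def G_def)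
      then show "ennreal (indicator {0..2 * pi} t * cmod (G (cis t)) powr q) = indicator {0..2 * pi} t * g (rot t p)"
        by (simp add: indicator_def)
    qed
    finally show ?thesis using True by (simp add: ennreal_leI)
  qed simp
  have rot_meas: "(\<lambda>x. rot (snd x) (fst x)) \<in> borel_measurable borel"
    unfolding rot_def by (intro borel_measurable_continuous_onI continuous_intros)
  have "(\<integral>\<^sup>+p. ennreal (2 * pi * X) * indicator Q p \<partial>lborel) \<le>
      (\<integral>\<^sup>+p. \<integral>\<^sup>+t. indicator {0..2 * pi} t * g (rot t p) \<partial>lborel \<partial>lborel)"
    by (intro nn_integral_mono point)
  also have "\<dots> = (\<integral>\<^sup>+t. \<integral>\<^sup>+p. indicator {0..2 * pi} t * g (rot t p) \<partial>lborel \<partial>lborel)"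
  proof (rule lborel_pair.Fubini'[symmetric])
    have [measurable]: "(\<lambda>x. g (rot (snd x) (fst x))) \<in> borel_measurable borel"
      using rot_meas g by measurable
    have [measurable]: "(snd :: (real \<times> real) \<times> real \<Rightarrow> real) \<in> borel_measurable borel"
      by (intro borel_measurable_continuous_onI continuous_intros)
    have "(\<lambda>x. indicator {0..2 * pi} (snd x) * g (rot (snd x) (fst x))) \<in> borel_measurable (borel :: ((real \<times> real) \<times> real) measure)"
      by measurable
    then show "(\<lambda>(p, t). indicator {0..2 * pi} t * g (rot t p)) \<in> borel_measurable (lborel \<Otimes>\<^sub>M lborel)"
      unfolding lborel_prod case_prod_beta by simp
  qed
  also have "\<dots> = (\<integral>\<^sup>+t. indicator {0..2 * pi} t * J \<partial>lborel)"
  proof (rule nn_integral_cong_AE)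
    \<comment> \<open>The two angles with vanishing cosine, which the lemma on rotations excludes, form a null set.\<close>
    have "AE t in lborel. t \<noteq> pi / 2 \<and> t \<noteq> 3 * pi / 2"
      using AE_lborel_singleton[of "pi / 2"] AE_lborel_singleton[of "3 * pi / 2"] by auto
    then show "AE t in lborel. (\<integral>\<^sup>+p. indicator {0..2 * pi} t * g (rot t p) \<partial>lborel) = indicator {0..2 * pi} t * J"
    proof eventually_elim
      case (elim t)
      show ?case
      proof (cases "t \<in> {0..2 * pi}")
        case True
        have "cos t \<noteq> 0"
        proof
          assume "cos t = 0"
          then obtain n :: int where n: "odd n" "t = of_int n * (pi / 2)"
            using cos_zero_iff_int by blast
          then have "0 * (pi / 2) \<le> of_int n * (pi / 2)" "of_int n * (pi / 2) \<le> 4 * (pi / 2)"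
            unfolding n(2)[symmetric] using True by auto
          then have "0 \<le> n" "n \<le> 4"
            by (simp_all only: mult_le_cancel_right) auto
          then have "n = 1 \<or> n = 3" using n(1) by presburger
          then show False using elim n(2) by auto
        qed
        then have "(\<integral>\<^sup>+p. g (rot t p) \<partial>lborel) = J"
          unfolding J_def rot_def by (intro nn_integral_rotation g) auto
        then show ?thesis using True by simp
      qed simp
    qed
  qed
  also have "\<dots> = ennreal (2 * pi) * J"
    by (subst nn_integral_multc) (auto)
  finally have integrated: "ennreal (2 * pi * X) * emeasure lborel Q \<le> ennreal (2 * pi) * J"
    by (subst (asm) nn_integral_cmult_indicator) (auto simp: Q_def intro!: borel_Times)
  have area: "emeasure lborel Q = ennreal (4 * \<rho>\<^sup>2)"
    using emeasure_lborel_cbox_eq[of "(-\<rho>, -\<rho>)" "(\<rho>, \<rho>)"] \<rho>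
    by (simp add: Q_def cbox_Pair_eq Basis_prod_def power2_eq_square)
  have J_le: "J \<le> ennreal (4 * \<rho>) * A"
  proof -
    have "J = (\<integral>\<^sup>+y. \<integral>\<^sup>+x. g (x, y) \<partial>lborel \<partial>lborel)"
      unfolding J_def by (rule nn_integral_lborel_iterated(2)[OF g])
    also have "\<dots> \<le> (\<integral>\<^sup>+y. A * indicator {-2 * \<rho>..2 * \<rho>} y \<partial>lborel)"
    proof (intro nn_integral_mono)
      fix y :: real
      show "(\<integral>\<^sup>+x. g (x, y) \<partial>lborel) \<le> A * indicator {-2 * \<rho>..2 * \<rho>} y"
      proof (cases "y \<in> {-2 * \<rho>..2 * \<rho>}")
        case True
        then have pos: "0 < Im z + y" using \<rho> by auto
        have "z + of_real x + \<i> * of_real y = Complex (Re z + 1 * x) (Im z + y)" for x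
          by (simp add: complex_eq_iff)
        then have "g (x, y) = ennreal (cmod (F (Complex (Re z + 1 * x) (Im z + y))) powr q)" for x
          using True pos by (simp add: g_def E_def upper_half_plane_def)
        then have "(\<integral>\<^sup>+x. g (x, y) \<partial>lborel) = line_integral_powr q F (Im z + y)"
          unfolding line_integral_powr_def
          using nn_integral_real_affine[of "\<lambda>x. ennreal (cmod (F (Complex x (Im z + y))) powr q)" 1 "Re z"]
            borel_measurable_horizontal_powr[OF holomorphic_on_imp_continuous_on[OF hol] pos q] by simp
        then show ?thesis using A[OF pos] True by simp
      qed (simp add: g_def)
    qed
    also have "\<dots> = ennreal (4 * \<rho>) * A"
      using \<rho> by (simp add: nn_integral_cmult_indicator mult.commute)
    finally show ?thesis .
  qed
  have "ennreal (2 * pi * X) * ennreal (4 * \<rho>\<^sup>2) \<le> ennreal (2 * pi) * (ennreal (4 * \<rho>) * A)"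
    using order_trans[OF integrated mult_left_mono[OF J_le]] by (simp add: area)
  moreover have "ennreal (2 * pi * X) * ennreal (4 * \<rho>\<^sup>2) = ennreal (8 * pi * \<rho>) * ennreal (\<rho> * X)"
    using \<rho> by (simp add: X_def power2_eq_square algebra_simps flip: ennreal_mult)
  moreover have "ennreal (2 * pi) * (ennreal (4 * \<rho>) * A) = ennreal (8 * pi * \<rho>) * A"
    using \<rho> by (simp add: algebra_simps flip: ennreal_mult mult.assoc)
  ultimately show ?thesis
    unfolding X_def using \<rho> by (simp add: ennreal_mult_le_mult_iff)
qed

section \<open>A substitute for uniform convexity\<close>

text \<open>A penalty argument: where \<open>h \<le> 0\<close>, the function \<open>g\<close> is positive and hence, by compactness, bounded
away from \<open>0\<close>.\<close>

lemma compact_pos_plus_multiple: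
  fixes g h :: "'a::topological_space \<Rightarrow> real"
  assumes X: "compact X" and g: "continuous_on X g" and h: "continuous_on X h"
    and g0: "\<And>x. x \<in> X \<Longrightarrow> 0 \<le> g x" and gh: "\<And>x. x \<in> X \<Longrightarrow> g x = 0 \<Longrightarrow> 0 < h x"
  shows "\<exists>C\<ge>0. \<forall>x\<in>X. 0 < h x + C * g x"
proof -
  define Y where "Y = {x \<in> X. h x \<le> 0}"
  have "Y = X \<inter> h -` {..0}" by (auto simp: Y_def)
  then have Y: "compact Y"
    using continuous_closedin_preimage[OF h closed_atMost] closedin_compact[OF X] by metis
  show ?thesis
  proof (cases "Y = {}")
    case True
    then show ?thesis by (intro exI[of _ 0]) (force simp: Y_def not_le)
  next
    case False
    have YX: "Y \<subseteq> X" by (auto simp: Y_def)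
    obtain a where a: "a \<in> Y" "\<And>x. x \<in> Y \<Longrightarrow> g a \<le> g x"
      using continuous_attains_inf[OF Y False continuous_on_subset[OF g YX]] by blast
    obtain b where b: "b \<in> Y" "\<And>x. x \<in> Y \<Longrightarrow> h b \<le> h x"
      using continuous_attains_inf[OF Y False continuous_on_subset[OF h YX]] by blast
    have ga: "0 < g a" using a(1) g0[of a] gh[of a] by (force simp: Y_def)
    have hb: "h b \<le> 0" using b(1) by (simp add: Y_def)
    define C where "C = (1 - h b) / g a"
    have C0: "0 \<le> C" using ga hb by (simp add: C_def)
    show ?thesis
    proof (intro exI[of _ C] conjI ballI C0)
      fix x assume x: "x \<in> X"
      show "0 < h x + C * g x"
      proof (cases "x \<in> Y")
        case True
        have "C * g a \<le> C * g x" using a(2)[OF True] C0 by (intro mult_left_mono)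
        moreover have "C * g a = 1 - h b" using ga by (simp add: C_def)
        ultimately show ?thesis using b(2)[OF True] by linarith
      next
        case False
        then show ?thesis using x C0 g0[OF x] by (auto simp: Y_def intro!: add_pos_nonneg)
      qed
    qed
  qed
qed

text \<open>For \<open>p > 1\<close> uniform convexity would control \<open>u - v\<close> by the gap in the inequality for the mean
\<open>(u + v) / 2\<close> alone. For \<open>p \<le> 1\<close> that gap may vanish or be negative although \<open>u \<noteq> v\<close>,
but only where the moduli of \<open>u\<close> and \<open>v\<close> differ, and this is detected by the gap in the inequality of arithmetic and geometric means for \<open>u * v\<close>. Both
\<open>(u + v) / 2\<close> and \<open>u * v\<close> are holomorphic in \<open>u\<close> and \<open>v\<close>, so for holomorphic functions the integrals of
the corresponding terms decrease with the height. The inequality is homogeneous of degree \<open>p\<close>, hence a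
statement on a compact sphere, where two penalty arguments produce the constants: \<open>D\<close> on the set of
equal moduli, then \<open>C\<close> on the whole sphere.\<close>

lemma powr_norm_diff_le_gaps:
  fixes p \<epsilon> :: real
  assumes p: "0 < p" and \<epsilon>: "0 < \<epsilon>"
  obtains C D where "0 \<le> C" "0 \<le> D"
    "\<And>u v :: complex. cmod (u - v) powr p + 2 * C * cmod (u * v) powr (p / 2) + D * cmod ((u + v) / 2) powr p
        \<le> (\<epsilon> + C + D / 2) * (cmod u powr p + cmod v powr p)"
proof -
  define S where "S = {x :: complex \<times> complex. cmod (fst x) powr p + cmod (snd x) powr p = 1}"
  define d where "d x = cmod (fst x - snd x) powr p" for x :: "complex \<times> complex"
  define m where "m x = cmod ((fst x + snd x) / 2) powr p" for x :: "complex \<times> complex"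
  define gm where "gm x = cmod (fst x * snd x) powr (p / 2)" for x :: "complex \<times> complex"
  have cont[continuous_intros]: "continuous_on X d" "continuous_on X m" "continuous_on X gm" for X
    unfolding d_def m_def gm_def by (intro continuous_on_powr' continuous_intros; use p in auto)+
  have "compact S"
  proof -
    have "closed S"
      unfolding S_def using p by (intro closed_Collect_eq continuous_on_powr' continuous_intros) auto
    moreover have "S \<subseteq> cball 0 1 \<times> cball 0 1"
    proof
      fix x assume x: "x \<in> S"
      have le: "cmod u \<le> 1" if "cmod u powr p \<le> 1" for u
        using that p by (metis gr_one_powr not_le)
      have "cmod (fst x) powr p \<le> 1" "cmod (snd x) powr p \<le> 1"
        using x powr_ge_zero[of "cmod (fst x)" p] powr_ge_zero[of "cmod (snd x)" p]
        unfolding S_def mem_Collect_eq by linarith+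
      then show "x \<in> cball 0 1 \<times> cball 0 1" using le by (cases x) auto
    qed
    moreover have "compact (cball (0::complex) 1 \<times> cball (0::complex) 1)"
      by (intro compact_Times compact_cball)
    ultimately show ?thesis by (metis compact_Int_closed inf.absorb2)
  qed
  define S' where "S' = {x \<in> S. cmod (fst x) = cmod (snd x)}"
  have half: "cmod (fst x) powr p = 1 / 2" if "x \<in> S'" for x
    using that by (auto simp: S'_def S_def)
  have "compact S'"
  proof -
    have "closed {x :: complex \<times> complex. cmod (fst x) = cmod (snd x)}"
      by (intro closed_Collect_eq continuous_intros)
    moreover have "S' = S \<inter> {x. cmod (fst x) = cmod (snd x)}" by (auto simp: S'_def)
    ultimately show ?thesis using \<open>compact S\<close> by (simp add: compact_Int_closed)
  qed
  then have "\<exists>D\<ge>0. \<forall>x\<in>S'. 0 < (\<epsilon> - d x) + D * (1 / 2 - m x)"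
  proof (rule compact_pos_plus_multiple)
    fix x assume x: "x \<in> S'"
    have tri: "cmod ((fst x + snd x) / 2) \<le> cmod (fst x)"
      using x norm_triangle_ineq[of "fst x" "snd x"] by (simp add: S'_def norm_divide)
    then have "m x \<le> cmod (fst x) powr p" unfolding m_def using p by (intro powr_mono2) auto
    then show "0 \<le> 1 / 2 - m x" using half[OF x] by simp
    assume "1 / 2 - m x = 0"
    then have "cmod ((fst x + snd x) / 2) powr p = cmod (fst x) powr p"
      using half[OF x] by (simp add: m_def)
    then have "cmod ((fst x + snd x) / 2) = cmod (fst x)"
      using p powr_inj[of p] tri powr_less_mono2[of p "cmod ((fst x + snd x) / 2)" "cmod (fst x)"] by force
    then have "cmod (fst x + snd x) = cmod (fst x) + cmod (snd x)"
      using x by (simp add: S'_def norm_divide)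
    then have "cmod (fst x) *\<^sub>R snd x = cmod (snd x) *\<^sub>R fst x"
      by (simp add: norm_triangle_eq)
    moreover have "cmod (fst x) \<noteq> 0" using half[OF x] p by force
    ultimately have "fst x = snd x" using x by (auto simp: S'_def)
    then show "0 < \<epsilon> - d x" using \<epsilon> p by (simp add: d_def)
  qed (intro continuous_intros)+
  then obtain D where D: "0 \<le> D" "\<And>x. x \<in> S' \<Longrightarrow> 0 < (\<epsilon> - d x) + D * (1 / 2 - m x)"
    by blast
  have "\<exists>C\<ge>0. \<forall>x\<in>S. 0 < (\<epsilon> - d x + D * (1 / 2 - m x)) + C * (1 - 2 * gm x)"
  proof (rule compact_pos_plus_multiple[OF \<open>compact S\<close>])
    fix x assume x: "x \<in> S"
    define a b where "a = cmod (fst x) powr (p / 2)" and "b = cmod (snd x) powr (p / 2)"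
    have sq: "a\<^sup>2 = cmod (fst x) powr p" "b\<^sup>2 = cmod (snd x) powr p"
      by (simp_all add: a_def b_def power2_eq_square flip: powr_add)
    have "a\<^sup>2 + b\<^sup>2 = 1" using x by (simp add: sq S_def)
    moreover have "gm x = a * b" by (simp add: gm_def a_def b_def norm_mult powr_mult)
    ultimately have gap: "1 - 2 * gm x = (a - b)\<^sup>2" by (simp add: power2_eq_square algebra_simps)
    then show "0 \<le> 1 - 2 * gm x" by simp
    assume "1 - 2 * gm x = 0"
    then have "a = b" using gap by simp
    then have "cmod (fst x) powr p = cmod (snd x) powr p" using sq by simp
    then have "cmod (fst x) = cmod (snd x)"
      using p powr_less_mono2[of p "cmod (fst x)" "cmod (snd x)"]
        powr_less_mono2[of p "cmod (snd x)" "cmod (fst x)"] by force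
    then have "x \<in> S'" using x by (simp add: S'_def)
    then show "0 < \<epsilon> - d x + D * (1 / 2 - m x)" by (rule D(2))
  qed (intro continuous_intros)+
  then obtain C where C: "0 \<le> C"
      "\<And>x. x \<in> S \<Longrightarrow> 0 < (\<epsilon> - d x + D * (1 / 2 - m x)) + C * (1 - 2 * gm x)"
    by blast
  show thesis
  proof (rule that[OF C(1) D(1)])
    fix u v :: complex
    define E where "E = cmod u powr p + cmod v powr p"
    show "cmod (u - v) powr p + 2 * C * cmod (u * v) powr (p / 2) + D * cmod ((u + v) / 2) powr p
        \<le> (\<epsilon> + C + D / 2) * (cmod u powr p + cmod v powr p)"
    proof (cases "u = 0 \<and> v = 0")
      case False
      have E: "0 < E"
        using False by (auto simp: E_def intro: add_pos_nonneg add_nonneg_pos)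
      define k where "k = E powr (- (1 / p))"
      have k: "0 < k" "k powr p = 1 / E"
        using E p powr_neg_one[OF E] unfolding k_def powr_powr by auto
      have scale: "cmod (of_real k * w) powr p = cmod w powr p / E" for w
        using k by (simp add: norm_mult powr_mult)
      define x where "x = (of_real k * u, of_real k * v)"
      have "x \<in> S"
        unfolding S_def x_def mem_Collect_eq fst_conv snd_conv scale
        using E by (simp add: E_def flip: add_divide_distrib)
      then have pos: "0 < (\<epsilon> - d x + D * (1 / 2 - m x)) + C * (1 - 2 * gm x)" by (rule C(2))
      have dx: "d x = cmod (u - v) powr p / E"
        using scale[of "u - v"] by (simp add: d_def x_def right_diff_distrib)
      have mx: "m x = cmod ((u + v) / 2) powr p / E"
        using scale[of "(u + v) / 2"] by (simp add: m_def x_def distrib_left add_divide_distrib)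
      have gx: "gm x = cmod (u * v) powr (p / 2) / E"
      proof -
        have "gm x = ((k * k) * cmod (u * v)) powr (p / 2)"
          using k by (simp add: gm_def x_def norm_mult mult_ac)
        also have "\<dots> = (k powr (p / 2) * k powr (p / 2)) * cmod (u * v) powr (p / 2)"
          using k by (simp add: powr_mult)
        also have "k powr (p / 2) * k powr (p / 2) = 1 / E"
          using k by (simp flip: powr_add)
        finally show ?thesis by simp
      qed
      have "0 < ((\<epsilon> - d x + D * (1 / 2 - m x)) + C * (1 - 2 * gm x)) * E"
        using pos E by simp
      also have "\<dots> = (\<epsilon> + C + D / 2) * E - (cmod (u - v) powr p + 2 * C * cmod (u * v) powr (p / 2)
            + D * cmod ((u + v) / 2) powr p)"
        unfolding dx mx gx using E by (simp add: field_simps)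
      finally show ?thesis by (simp add: E_def)
    qed (use p in simp)
  qed
qed

section \<open>Continuity of vertical translation\<close>

lemma holomorphic_on_shift_up:
  assumes "F holomorphic_on upper_half_plane" and "0 \<le> a"
  shows "(\<lambda>z. F (z + \<i> * of_real a)) holomorphic_on upper_half_plane"
proof -
  have "(\<lambda>z. z + \<i> * of_real a) holomorphic_on upper_half_plane"
    by (intro holomorphic_intros)
  moreover have "(\<lambda>z. z + \<i> * of_real a) ` upper_half_plane \<subseteq> upper_half_plane"
    using assms(2) by (auto simp: upper_half_plane_def)
  ultimately show ?thesis
    using holomorphic_on_compose_gen[OF _ assms(1)] by (simp add: o_def)
qed

lemma Complex_shift_up: "Complex x y + \<i> * of_real a = Complex x (y + a)"
  by (simp add: complex_eq_iff)

lemma line_integral_shift_up: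
  "line_integral_powr q (\<lambda>z. F (z + \<i> * of_real a)) y = line_integral_powr q F (y + a)"
  by (simp add: line_integral_powr_def Complex_shift_up)

text \<open>Raising the pairing of \<open>F\<close> at heights \<open>a\<close> and \<open>b\<close> by a fixed amount decreases its integral, because the
pairing is again holomorphic; as \<open>a\<close> and \<open>b\<close> tend to \<open>0\<close>, the raised pairing tends pointwise to the one
of \<open>F\<close> with itself at height \<open>s\<close>, and Fatou's lemma applies.\<close>

lemma line_integral_eventually_le_pairing:
  assumes hol: "F holomorphic_on upper_half_plane" and p: "0 < p" and q: "0 < q"
    and A: "\<And>y. 0 < y \<Longrightarrow> line_integral_powr p F y \<le> A" "A < top"
    and T_cont: "continuous_on UNIV (\<lambda>(u, v). T u v)"
    and T_hol: "\<And>f g. f holomorphic_on upper_half_plane \<Longrightarrow> g holomorphic_on upper_half_plane \<Longrightarrow>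
        (\<lambda>z. T (f z) (g z)) holomorphic_on upper_half_plane"
    and T_le: "\<And>u v. cmod (T u v) powr q \<le> cmod u powr p + cmod v powr p"
    and T_diag: "\<And>u. cmod (T u u) powr q = cmod u powr p"
    and s: "0 < s" and \<eta>: "0 < \<eta>"
  shows "\<exists>\<delta>>0. \<forall>a b. 0 < a \<and> a < \<delta> \<and> 0 < b \<and> b < \<delta> \<longrightarrow>
    line_integral_powr p F s \<le>
      (\<integral>\<^sup>+x. ennreal (cmod (T (F (Complex x a)) (F (Complex x b))) powr q) \<partial>lborel) + ennreal \<eta>"
proof (rule ccontr)
  define J where "J a b = (\<integral>\<^sup>+x. ennreal (cmod (T (F (Complex x a)) (F (Complex x b))) powr q) \<partial>lborel)" for a b
  assume "\<not> ?thesis"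
  then have neg: "\<exists>a b. 0 < a \<and> a < \<delta> \<and> 0 < b \<and> b < \<delta> \<and> J a b + ennreal \<eta> < line_integral_powr p F s"
    if "0 < \<delta>" for \<delta>
    using that unfolding J_def not_le[symmetric] by blast
  have "\<exists>a b. 0 < a \<and> a < min s (1 / real (Suc n)) \<and> 0 < b \<and> b < min s (1 / real (Suc n)) \<and>
      J a b + ennreal \<eta> < line_integral_powr p F s" for n
    by (rule neg) (use s in auto)
  then obtain a b where ab: "\<And>n. 0 < a n" "\<And>n. a n < min s (1 / real (Suc n))"
      "\<And>n. 0 < b n" "\<And>n. b n < min s (1 / real (Suc n))"
      "\<And>n. J (a n) (b n) + ennreal \<eta> < line_integral_powr p F s"
    by metis
  \<comment> \<open>The line of the pairing has to lie inside the upper half plane: half of the smaller height is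
    kept as the height of that line, and only the rest is moved into the shifts \<open>\<alpha>\<close> and \<open>\<beta>\<close>.\<close>
  define m where "m n = min (a n) (b n) / 2" for n
  define \<alpha> where "\<alpha> n = a n - m n" for n
  define \<beta> where "\<beta> n = b n - m n" for n
  have m: "0 < m n" "m n \<le> s" and \<alpha>: "0 \<le> \<alpha> n" "\<alpha> n \<le> 1 / real (Suc n)"
    and \<beta>: "0 \<le> \<beta> n" "\<beta> n \<le> 1 / real (Suc n)" for n
    using ab(1)[of n] ab(2)[of n] ab(3)[of n] ab(4)[of n] by (auto simp: m_def \<alpha>_def \<beta>_def)
  have \<alpha>_lim: "\<alpha> \<longlonglongrightarrow> 0" and \<beta>_lim: "\<beta> \<longlonglongrightarrow> 0"
    by (rule tendsto_sandwich[OF _ _ tendsto_const LIMSEQ_Suc[OF lim_1_over_n]]; use \<alpha> \<beta> in simp)+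
  define W where "W n z = T (F (z + \<i> * of_real (\<alpha> n))) (F (z + \<i> * of_real (\<beta> n)))" for n z
  have W_hol: "W n holomorphic_on upper_half_plane" for n
    unfolding W_def[abs_def] by (intro T_hol holomorphic_on_shift_up hol \<alpha> \<beta>)
  have contF: "continuous_on upper_half_plane F"
    by (rule holomorphic_on_imp_continuous_on[OF hol])
  have W_bound: "line_integral_powr q (W n) y \<le> A + A" if y: "0 < y" for n y
  proof -
    have "line_integral_powr q (W n) y \<le> (\<integral>\<^sup>+x. ennreal (cmod (F (Complex x (y + \<alpha> n))) powr p)
        + ennreal (cmod (F (Complex x (y + \<beta> n))) powr p) \<partial>lborel)"
      unfolding line_integral_powr_def W_def Complex_shift_up
      by (intro nn_integral_mono) (use T_le in \<open>simp flip: ennreal_plus\<close>)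
    also have "\<dots> = line_integral_powr p F (y + \<alpha> n) + line_integral_powr p F (y + \<beta> n)"
      unfolding line_integral_powr_def
      by (intro nn_integral_add measurable_compose[OF _ measurable_ennreal])
         (use borel_measurable_horizontal_powr[OF contF _ p] y \<alpha>[of n] \<beta>[of n] in \<open>auto simp: add_pos_nonneg\<close>)
    also have "\<dots> \<le> A + A"
      using y \<alpha>[of n] \<beta>[of n] by (intro add_mono A) auto
    finally show ?thesis .
  qed
  have "line_integral_powr p F s < top" using A s by (meson le_less_trans)
  then obtain i where i: "line_integral_powr p F s = ennreal i" "0 \<le> i"
    by (cases "line_integral_powr p F s") auto
  have W_small: "line_integral_powr q (W n) s \<le> ennreal (i - \<eta>)" for n
  proof -
    have "line_integral_powr q (W n) s \<le> line_integral_powr q (W n) (m n)"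
      by (rule line_integral_antimono[OF W_hol q W_bound _ m]) (use A(2) in auto)
    also have "\<dots> = J (a n) (b n)"
      unfolding line_integral_powr_def J_def W_def Complex_shift_up by (simp add: \<alpha>_def \<beta>_def)
    also have "\<dots> \<le> ennreal (i - \<eta>)"
    proof -
      have lt: "J (a n) (b n) + ennreal \<eta> < ennreal i" using ab(5)[of n] i(1) by simp
      then obtain j where j: "J (a n) (b n) = ennreal j" "0 \<le> j"
        by (cases "J (a n) (b n)") auto
      then have "j + \<eta> < i" using lt \<eta> by (simp flip: ennreal_plus add: ennreal_less_iff)
      then show ?thesis unfolding j(1) by (intro ennreal_leI) simp
    qed
    finally show ?thesis .
  qed
  have meas: "(\<lambda>x. ennreal (cmod (W n (Complex x s)) powr q)) \<in> borel_measurable lborel" for n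
    using borel_measurable_horizontal_powr[OF holomorphic_on_imp_continuous_on[OF W_hol] s q, of n] by simp
  have conv: "(\<lambda>n. ennreal (cmod (W n (Complex x s)) powr q)) \<longlonglongrightarrow> ennreal (cmod (F (Complex x s)) powr p)" for x
  proof -
    have lim: "(\<lambda>n. F (Complex x s + \<i> * of_real (\<gamma> n))) \<longlonglongrightarrow> F (Complex x s)"
      if "\<gamma> \<longlonglongrightarrow> 0" "\<And>n. 0 \<le> \<gamma> n" for \<gamma>
    proof (rule continuous_on_tendsto_compose[OF contF])
      have "(\<lambda>n. Complex x s + \<i> * of_real (\<gamma> n)) \<longlonglongrightarrow> Complex x s + \<i> * of_real 0"
        by (intro tendsto_intros that)
      then show "(\<lambda>n. Complex x s + \<i> * of_real (\<gamma> n)) \<longlonglongrightarrow> Complex x s" by simp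
    qed (use s that(2) in \<open>auto simp: upper_half_plane_def add_pos_nonneg\<close>)
    have "(\<lambda>n. (\<lambda>(u, v). T u v) (F (Complex x s + \<i> * of_real (\<alpha> n)), F (Complex x s + \<i> * of_real (\<beta> n))))
        \<longlonglongrightarrow> (\<lambda>(u, v). T u v) (F (Complex x s), F (Complex x s))"
      by (rule continuous_on_tendsto_compose[OF T_cont])
         (auto intro!: tendsto_Pair lim \<alpha>_lim \<beta>_lim \<alpha> \<beta>)
    then have "(\<lambda>n. W n (Complex x s)) \<longlonglongrightarrow> T (F (Complex x s)) (F (Complex x s))"
      by (simp add: W_def)
    then have "(\<lambda>n. cmod (W n (Complex x s)) powr q) \<longlonglongrightarrow> cmod (T (F (Complex x s)) (F (Complex x s))) powr q"
      using q by (intro tendsto_powr2 tendsto_intros) auto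
    then show ?thesis unfolding T_diag by (rule tendsto_ennrealI)
  qed
  have "ennreal i = (\<integral>\<^sup>+x. liminf (\<lambda>n. ennreal (cmod (W n (Complex x s)) powr q)) \<partial>lborel)"
    unfolding i(1)[symmetric] line_integral_powr_def
    by (intro nn_integral_cong lim_imp_Liminf[symmetric] conv) simp
  also have "\<dots> \<le> liminf (\<lambda>n. line_integral_powr q (W n) s)"
    unfolding line_integral_powr_def by (rule nn_integral_liminf[OF meas])
  also have "\<dots> \<le> liminf (\<lambda>n. ennreal (i - \<eta>))"
    by (intro Liminf_mono always_eventually allI W_small)
  also have "\<dots> = ennreal (i - \<eta>)" by (simp add: Liminf_const)
  finally have "ennreal i \<le> ennreal (i - \<eta>)" .
  moreover have "\<eta> < i"
  proof -
    have "ennreal \<eta> \<le> J (a 0) (b 0) + ennreal \<eta>" by simp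
    also have "\<dots> < ennreal i" using ab(5)[of 0] i(1) by simp
    finally show ?thesis using \<eta> by (simp add: ennreal_less_iff)
  qed
  ultimately show False using \<eta> by (simp add: ennreal_le_iff)
qed

lemma powr_norm_add_le:
  assumes p: "0 < p"
  shows "cmod (u + v) powr p \<le> 2 powr p * (cmod u powr p + cmod v powr p)"
proof -
  define M where "M = max (cmod u) (cmod v)"
  have "cmod (u + v) \<le> 2 * M" using norm_triangle_ineq[of u v] by (auto simp: M_def)
  then have "cmod (u + v) powr p \<le> (2 * M) powr p" using p by (intro powr_mono2) auto
  also have "\<dots> = 2 powr p * M powr p" by (simp add: powr_mult M_def)
  also have "M powr p \<le> cmod u powr p + cmod v powr p" by (auto simp: M_def max_def)
  finally show ?thesis by simp
qed

lemma line_integral_add_le: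
  assumes F: "continuous_on upper_half_plane F" and G: "continuous_on upper_half_plane G"
    and p: "0 < p" and y: "0 < y"
  shows "line_integral_powr p (\<lambda>z. F z + G z) y
    \<le> ennreal (2 powr p) * (line_integral_powr p F y + line_integral_powr p G y)"
proof -
  note [measurable] = borel_measurable_horizontal_powr[OF F y p] borel_measurable_horizontal_powr[OF G y p]
  have "line_integral_powr p (\<lambda>z. F z + G z) y \<le> (\<integral>\<^sup>+x. ennreal (2 powr p) *
     (ennreal (cmod (F (Complex x y)) powr p) + ennreal (cmod (G (Complex x y)) powr p)) \<partial>lborel)"
    unfolding line_integral_powr_def
    by (intro nn_integral_mono) (use powr_norm_add_le[OF p] in \<open>simp flip: ennreal_plus ennreal_mult\<close>)
  also have "\<dots> = ennreal (2 powr p) * (line_integral_powr p F y + line_integral_powr p G y)"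
    unfolding line_integral_powr_def by (subst nn_integral_cmult, measurable) (subst nn_integral_add, measurable)
  finally show ?thesis .
qed

lemma line_integral_uminus: "line_integral_powr p (\<lambda>z. - F z) y = line_integral_powr p F y"
  by (simp add: line_integral_powr_def)

text \<open>Let \<open>S\<close> be the supremum of the integrals over horizontal lines. In the pointwise inequality
\<open>powr_norm_diff_le_gaps\<close> the right-hand side integrates to at most the multiple \<open>2 * S\<close> of its constant,
and the integrals of the pairings \<open>u * v\<close> and \<open>(u + v) / 2\<close> are almost \<open>S\<close> near the boundary. What is left
for the difference is small.\<close>

lemma line_integral_Cauchy_at_boundary:
  assumes hol: "F holomorphic_on upper_half_plane" and p: "0 < p"
    and A: "\<And>y. 0 < y \<Longrightarrow> line_integral_powr p F y \<le> A" "A < top"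
    and \<epsilon>: "0 < \<epsilon>"
  shows "\<exists>\<delta>>0. \<forall>a b. 0 < a \<and> a < \<delta> \<and> 0 < b \<and> b < \<delta> \<longrightarrow>
      (\<integral>\<^sup>+x. ennreal (cmod (F (Complex x a) - F (Complex x b)) powr p) \<partial>lborel) \<le> ennreal \<epsilon>"
proof -
  have contF: "continuous_on upper_half_plane F"
    by (rule holomorphic_on_imp_continuous_on[OF hol])
  define S where "S = (SUP y\<in>{0<..}. line_integral_powr p F y)"
  have S_upper: "line_integral_powr p F y \<le> S" if "0 < y" for y
    using that unfolding S_def by (intro SUP_upper) auto
  have "S \<le> A" unfolding S_def by (intro SUP_least A) auto
  then obtain \<alpha> where \<alpha>: "S = ennreal \<alpha>" "0 \<le> \<alpha>" using A(2) by (cases S) (auto simp: top_unique)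
  define \<epsilon>' where "\<epsilon>' = \<epsilon> / (4 * (\<alpha> + 1))"
  have \<epsilon>': "0 < \<epsilon>'" "2 * \<epsilon>' * \<alpha> \<le> \<epsilon> / 2"
    using \<epsilon> \<alpha>(2) by (auto simp: \<epsilon>'_def field_simps)
  obtain C D where CD: "0 \<le> C" "0 \<le> D" and gaps:
    "\<And>u v :: complex. cmod (u - v) powr p + 2 * C * cmod (u * v) powr (p / 2) + D * cmod ((u + v) / 2) powr p
        \<le> (\<epsilon>' + C + D / 2) * (cmod u powr p + cmod v powr p)"
    by (rule powr_norm_diff_le_gaps[OF p \<epsilon>'(1)]) (blast intro: that)
  define \<eta> where "\<eta> = \<epsilon> / (4 * (2 * C + D + 1))"
  have \<eta>: "0 < \<eta>" "(2 * C + D) * (2 * \<eta>) \<le> \<epsilon> / 2"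
    using \<epsilon> CD by (auto simp: \<eta>_def field_simps)
  obtain s where s: "0 < s" "S \<le> line_integral_powr p F s + ennreal \<eta>"
  proof (cases "\<alpha> \<le> \<eta>")
    case True
    then show ?thesis using that[of 1] by (simp add: \<alpha> ennreal_leI add_increasing)
  next
    case False
    then have "ennreal (\<alpha> - \<eta>) < S" using \<eta>(1) by (simp add: \<alpha>(1) ennreal_less_iff)
    then obtain s where "0 < s" "ennreal (\<alpha> - \<eta>) < line_integral_powr p F s"
      unfolding S_def by (auto simp: less_SUP_iff)
    moreover have "S = ennreal (\<alpha> - \<eta>) + ennreal \<eta>"
      using False \<eta>(1) by (simp add: \<alpha>(1) flip: ennreal_plus)
    ultimately show ?thesis using that[of s] by (simp add: add_mono)
  qed
  have cont_mult: "continuous_on UNIV (\<lambda>(u, v). u * v :: complex)"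
    and cont_mean: "continuous_on UNIV (\<lambda>(u, v). (u + v) / 2 :: complex)"
    unfolding case_prod_beta by (auto intro!: continuous_intros)
  have sq: "cmod u powr (p / 2) * cmod u powr (p / 2) = cmod u powr p" for u
    by (simp flip: powr_add)
  have mult_le: "cmod (u * v) powr (p / 2) \<le> cmod u powr p + cmod v powr p" for u v
  proof -
    define a b where "a = cmod u powr (p / 2)" and "b = cmod v powr (p / 2)"
    have "0 \<le> (a - b)\<^sup>2" "0 \<le> a * b" by (auto simp: a_def b_def)
    then have "a * b \<le> a * a + b * b" by (simp add: power2_eq_square algebra_simps)
    then show ?thesis unfolding a_def b_def sq by (simp add: norm_mult powr_mult)
  qed
  have mean_le: "cmod ((u + v) / 2) powr p \<le> cmod u powr p + cmod v powr p" for u v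
  proof -
    have "cmod ((u + v) / 2) \<le> max (cmod u) (cmod v)"
      using norm_triangle_ineq[of u v] by (simp add: norm_divide max_def)
    then have "cmod ((u + v) / 2) powr p \<le> max (cmod u) (cmod v) powr p"
      using p by (intro powr_mono2) auto
    also have "\<dots> \<le> cmod u powr p + cmod v powr p" by (auto simp: max_def)
    finally show ?thesis .
  qed
  have mult_diag: "cmod (u * u) powr (p / 2) = cmod u powr p" for u
    by (simp add: norm_mult powr_mult sq)
  have mean_diag: "cmod ((u + u) / 2) powr p = cmod u powr p" for u
    by simp
  obtain \<delta>1 where \<delta>1: "0 < \<delta>1" "\<And>a b. 0 < a \<and> a < \<delta>1 \<and> 0 < b \<and> b < \<delta>1 \<Longrightarrow> line_integral_powr p F s \<le>
      (\<integral>\<^sup>+x. ennreal (cmod (F (Complex x a) * F (Complex x b)) powr (p / 2)) \<partial>lborel) + ennreal \<eta>"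
    using line_integral_eventually_le_pairing[OF hol p half_gt_zero[OF p] A cont_mult holomorphic_on_mult
        mult_le mult_diag s(1) \<eta>(1)] by blast
  have mean_hol: "(\<lambda>z. (f z + g z) / 2) holomorphic_on upper_half_plane"
    if "f holomorphic_on upper_half_plane" "g holomorphic_on upper_half_plane" for f g
    using that by (intro holomorphic_intros) auto
  obtain \<delta>2 where \<delta>2: "0 < \<delta>2" "\<And>a b. 0 < a \<and> a < \<delta>2 \<and> 0 < b \<and> b < \<delta>2 \<Longrightarrow> line_integral_powr p F s \<le>
      (\<integral>\<^sup>+x. ennreal (cmod ((F (Complex x a) + F (Complex x b)) / 2) powr p) \<partial>lborel) + ennreal \<eta>"
    using line_integral_eventually_le_pairing[OF hol p p A cont_mean mean_hol mean_le mean_diag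
        s(1) \<eta>(1)] by blast
  show ?thesis
  proof (intro exI[of _ "min \<delta>1 \<delta>2"] conjI allI impI; (elim conjE)?)
    show "0 < min \<delta>1 \<delta>2" using \<delta>1(1) \<delta>2(1) by simp
    fix a b assume ab: "0 < a" "a < min \<delta>1 \<delta>2" "0 < b" "b < min \<delta>1 \<delta>2"
    define u where "u x = F (Complex x a)" for x
    define v where "v x = F (Complex x b)" for x
    have cu[continuous_intros]: "continuous_on UNIV u" and cv[continuous_intros]: "continuous_on UNIV v"
      unfolding u_def v_def using ab
      by (auto intro!: continuous_on_compose2[OF contF] continuous_intros simp: upper_half_plane_def Complex_eq)
    have [measurable]: "u \<in> borel_measurable borel" "v \<in> borel_measurable borel"
      by (auto intro!: borel_measurable_continuous_onI continuous_intros)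
    define X where "X = (\<integral>\<^sup>+x. ennreal (cmod (u x - v x) powr p) \<partial>lborel)"
    define Y where "Y = (\<integral>\<^sup>+x. ennreal (cmod (u x * v x) powr (p / 2)) \<partial>lborel)"
    define Z where "Z = (\<integral>\<^sup>+x. ennreal (cmod ((u x + v x) / 2) powr p) \<partial>lborel)"
    define k where "k = \<epsilon>' + C + D / 2"
    have k: "0 \<le> k" using CD \<epsilon>'(1) by (simp add: k_def)
    have "X + ennreal (2 * C) * Y + ennreal D * Z = (\<integral>\<^sup>+x. ennreal (cmod (u x - v x) powr p
          + 2 * C * cmod (u x * v x) powr (p / 2) + D * cmod ((u x + v x) / 2) powr p) \<partial>lborel)"
      unfolding X_def Y_def Z_def using CD
      by (simp add: ennreal_plus ennreal_mult nn_integral_add nn_integral_cmult)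
    also have "\<dots> \<le> (\<integral>\<^sup>+x. ennreal (k * (cmod (u x) powr p + cmod (v x) powr p)) \<partial>lborel)"
      unfolding k_def by (intro nn_integral_mono ennreal_leI gaps)
    also have "\<dots> = ennreal k * (line_integral_powr p F a + line_integral_powr p F b)"
      using k by (simp add: line_integral_powr_def u_def[symmetric] v_def[symmetric] ennreal_plus ennreal_mult
          nn_integral_add nn_integral_cmult)
    also have "\<dots> \<le> ennreal k * (S + S)"
      using ab by (intro mult_left_mono add_mono S_upper) auto
    finally have upper: "X + ennreal (2 * C) * Y + ennreal D * Z \<le> ennreal (2 * k * \<alpha>)"
      using k \<alpha> by (simp flip: ennreal_plus ennreal_mult) (simp add: algebra_simps)
    have lowerY: "ennreal \<alpha> \<le> Y + ennreal (2 * \<eta>)"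
    proof -
      have "S \<le> (Y + ennreal \<eta>) + ennreal \<eta>"
        using s(2) add_right_mono[OF \<delta>1(2)[of a b], of "ennreal \<eta>"] ab
        by (fastforce simp: Y_def u_def v_def intro: order_trans)
      then show ?thesis using \<eta>(1) by (simp add: \<alpha>(1) add.assoc flip: ennreal_plus)
    qed
    have lowerZ: "ennreal \<alpha> \<le> Z + ennreal (2 * \<eta>)"
    proof -
      have "S \<le> (Z + ennreal \<eta>) + ennreal \<eta>"
        using s(2) add_right_mono[OF \<delta>2(2)[of a b], of "ennreal \<eta>"] ab
        by (fastforce simp: Z_def u_def v_def intro: order_trans)
      then show ?thesis using \<eta>(1) by (simp add: \<alpha>(1) add.assoc flip: ennreal_plus)
    qed
    have fin: "Y \<le> S + S" "Z \<le> S + S"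
    proof -
      have "(\<integral>\<^sup>+x. ennreal (cmod (u x) powr p + cmod (v x) powr p) \<partial>lborel) \<le> S + S"
        using add_mono[OF S_upper[OF ab(1)] S_upper[OF ab(3)]]
        by (simp add: line_integral_powr_def u_def[symmetric] v_def[symmetric] ennreal_plus nn_integral_add)
      moreover have "Y \<le> (\<integral>\<^sup>+x. ennreal (cmod (u x) powr p + cmod (v x) powr p) \<partial>lborel)"
        unfolding Y_def by (intro nn_integral_mono ennreal_leI mult_le)
      moreover have "Z \<le> (\<integral>\<^sup>+x. ennreal (cmod (u x) powr p + cmod (v x) powr p) \<partial>lborel)"
        unfolding Z_def by (intro nn_integral_mono ennreal_leI mean_le)
      ultimately show "Y \<le> S + S" "Z \<le> S + S" by (blast intro: order_trans)+
    qed
    obtain Y' where Y': "Y = ennreal Y'" "0 \<le> Y'" using fin(1) \<alpha> by (cases Y) (auto simp: top_unique)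
    obtain Z' where Z': "Z = ennreal Z'" "0 \<le> Z'" using fin(2) \<alpha> by (cases Z) (auto simp: top_unique)
    have "X \<le> X + ennreal (2 * C) * Y + ennreal D * Z" by (simp add: add.assoc)
    with upper obtain X' where X': "X = ennreal X'" "0 \<le> X'" by (cases X) (auto simp: top_unique)
    have "X' + 2 * C * Y' + D * Z' \<le> 2 * k * \<alpha>"
      using upper CD k \<alpha>(2) X'(2) Y'(2) Z'(2)
      by (simp add: X'(1) Y'(1) Z'(1) flip: ennreal_plus ennreal_mult)
    moreover have "\<alpha> \<le> Y' + 2 * \<eta>" "\<alpha> \<le> Z' + 2 * \<eta>"
      using lowerY lowerZ \<eta>(1) Y'(2) Z'(2) by (simp_all add: Y'(1) Z'(1) flip: ennreal_plus)
    then have "2 * C * \<alpha> \<le> 2 * C * (Y' + 2 * \<eta>)" "D * \<alpha> \<le> D * (Z' + 2 * \<eta>)"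
      using CD by (auto intro!: mult_left_mono)
    ultimately have "X' \<le> 2 * \<epsilon>' * \<alpha> + (2 * C + D) * (2 * \<eta>)"
      by (simp add: k_def algebra_simps)
    then have "X' \<le> \<epsilon>" using \<epsilon>'(2) \<eta>(2) by linarith
    then show "(\<integral>\<^sup>+x. ennreal (cmod (F (Complex x a) - F (Complex x b)) powr p) \<partial>lborel) \<le> ennreal \<epsilon>"
      using X'(1) by (simp add: X_def u_def v_def ennreal_leI)
  qed
qed

text \<open>The difference of \<open>F\<close> and its translate has the largest integrals near the boundary, where the
Cauchy property controls them.\<close>

lemma line_integral_translation_small:
  assumes hol: "F holomorphic_on upper_half_plane" and p: "0 < p"
    and A: "\<And>y. 0 < y \<Longrightarrow> line_integral_powr p F y \<le> A" "A < top"
    and \<epsilon>: "0 < \<epsilon>"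
  obtains h where "0 < h"
    "\<And>y. 0 < y \<Longrightarrow> line_integral_powr p (\<lambda>z. F z - F (z + \<i> * of_real h)) y \<le> ennreal \<epsilon>"
proof -
  obtain \<delta> where \<delta>: "0 < \<delta>" "\<And>a b. 0 < a \<Longrightarrow> a < \<delta> \<Longrightarrow> 0 < b \<Longrightarrow> b < \<delta> \<Longrightarrow>
      (\<integral>\<^sup>+x. ennreal (cmod (F (Complex x a) - F (Complex x b)) powr p) \<partial>lborel) \<le> ennreal \<epsilon>"
    using line_integral_Cauchy_at_boundary[OF hol p A \<epsilon>] by blast
  define h where "h = \<delta> / 2"
  have h: "0 < h" using \<delta>(1) by (simp add: h_def)
  define W where "W z = F z - F (z + \<i> * of_real h)" for z
  have shift_hol: "(\<lambda>z. F (z + \<i> * of_real h)) holomorphic_on upper_half_plane"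
    using holomorphic_on_shift_up[OF hol] h by simp
  have W_hol: "W holomorphic_on upper_half_plane"
    unfolding W_def[abs_def] by (intro holomorphic_intros hol shift_hol)
  have W_bound: "line_integral_powr p W y \<le> ennreal (2 powr p) * (A + A)" if y: "0 < y" for y
  proof -
    have "line_integral_powr p (\<lambda>z. F z + - F (z + \<i> * of_real h)) y \<le>
        ennreal (2 powr p) * (line_integral_powr p F y + line_integral_powr p (\<lambda>z. - F (z + \<i> * of_real h)) y)"
      by (intro line_integral_add_le holomorphic_on_imp_continuous_on holomorphic_intros hol shift_hol p y)
    also have "\<dots> \<le> ennreal (2 powr p) * (A + A)"
      unfolding line_integral_uminus line_integral_shift_up
      using y h by (intro mult_left_mono add_mono A) auto
    finally show ?thesis by (simp add: W_def[abs_def])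
  qed
  have "line_integral_powr p W y \<le> ennreal \<epsilon>" if y: "0 < y" for y
  proof -
    define y' where "y' = min y (h / 2)"
    have y': "0 < y'" "y' \<le> y" "y' < \<delta>" "y' + h < \<delta>" using y h \<delta>(1) by (auto simp: y'_def h_def)
    have "line_integral_powr p W y \<le> line_integral_powr p W y'"
      by (rule line_integral_antimono[OF W_hol p W_bound _ y'(1,2)])
         (use A(2) in \<open>auto simp: ennreal_mult_less_top\<close>)
    also have "\<dots> \<le> ennreal \<epsilon>"
      using \<delta>(2)[of y' "y' + h"] y' h by (simp add: line_integral_powr_def W_def Complex_shift_up)
    finally show ?thesis .
  qed
  then show thesis using that[OF h] by (simp add: W_def[abs_def])
qed

section \<open>The Hardy space in terms of integrals over lines\<close>

lemma hardy_norm_leI: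
  assumes p: "0 < p" and K: "0 \<le> K" and le: "\<And>y. 0 < y \<Longrightarrow> line_integral_powr p f y \<le> ennreal K"
  shows "hardy_norm p f \<le> ennreal (K powr (1 / p))"
  unfolding hardy_norm_def
proof (rule SUP_least)
  fix y :: real assume "y \<in> {0<..}"
  then have L: "line_integral_powr p f y \<le> ennreal K" using le by simp
  then have "enn2real (line_integral_powr p f y) \<le> K" using K by (simp add: enn2real_leI)
  then have "enn2real (line_integral_powr p f y) powr (1 / p) \<le> K powr (1 / p)"
    using p by (intro powr_mono2) auto
  then show "ennreal_powr (line_integral_powr p f y) (1 / p) \<le> ennreal (K powr (1 / p))"
    using L by (auto simp: ennreal_powr_def top_unique intro: ennreal_leI)
qed

text \<open>All later estimates are stated for the integrals over lines, which removes the distinction between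
the norm for \<open>p \<ge> 1\<close> and the metric for \<open>p < 1\<close>.\<close>

lemma hardy_space_iff:
  assumes p: "0 < p"
  shows "f \<in> hardy_space p \<longleftrightarrow> f holomorphic_on upper_half_plane \<and>
    (\<exists>K. \<forall>y>0. line_integral_powr p f y \<le> ennreal K)"
proof -
  have "\<exists>K. \<forall>y>0. line_integral_powr p f y \<le> ennreal K" if fin: "hardy_norm p f < top"
  proof -
    obtain c where c: "hardy_norm p f = ennreal c" "0 \<le> c"
      using fin by (cases "hardy_norm p f") auto
    have "line_integral_powr p f y \<le> ennreal (c powr p)" if y: "0 < y" for y
    proof -
      have le: "ennreal_powr (line_integral_powr p f y) (1 / p) \<le> ennreal c"
        unfolding c(1)[symmetric] hardy_norm_def using y by (intro SUP_upper) auto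
      then obtain I where I: "line_integral_powr p f y = ennreal I" "0 \<le> I"
        by (cases "line_integral_powr p f y") (auto simp: ennreal_powr_def top_unique)
      then have "I powr (1 / p) \<le> c" using le c(2) by (simp add: ennreal_powr_def)
      then have "(I powr (1 / p)) powr p \<le> c powr p" using p by (intro powr_mono2) auto
      then have "I \<le> c powr p" using p I(2) by (simp add: powr_powr)
      then show ?thesis using I(1) by (simp add: ennreal_leI)
    qed
    then show ?thesis by blast
  qed
  moreover have "hardy_norm p f < top" if bound: "\<forall>y>0. line_integral_powr p f y \<le> ennreal K" for K
  proof -
    have "hardy_norm p f \<le> ennreal (max K 0 powr (1 / p))"
      by (rule hardy_norm_leI[OF p]) (use bound in \<open>auto intro: order_trans[OF _ ennreal_leI]\<close>)
    then show ?thesis by (meson ennreal_less_top le_less_trans)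
  qed
  ultimately show ?thesis unfolding hardy_space_def by blast
qed

section \<open>Functions with polynomial decay\<close>

lemma nn_integral_Complex_powr_finite:
  assumes s: "1 < s"
  shows "(\<integral>\<^sup>+x. ennreal (cmod (Complex x 1) powr (- s)) \<partial>lborel) < top"
proof -
  define g where "g x = indicator {1..} x * x powr (- s)" for x :: real
  have [measurable]: "g \<in> borel_measurable borel" unfolding g_def by measurable
  have "((\<lambda>x. x powr (- s)) has_integral - (1 powr (- s + 1)) / (- s + 1)) {1..}"
    using has_integral_powr_to_inf[of "- s" 1] s by simp
  from nn_integral_has_integral_lebesgue[OF _ this]
  have g_fin: "(\<integral>\<^sup>+x. ennreal (g x) \<partial>lborel) < top"
    by (simp add: g_def)
  moreover have "(\<integral>\<^sup>+x. ennreal (g (- x)) \<partial>lborel) = (\<integral>\<^sup>+x. ennreal (g x) \<partial>lborel)"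
    using nn_integral_real_affine[of "\<lambda>x. ennreal (g x)" "-1" 0] by simp
  moreover have "(\<integral>\<^sup>+x. indicator {-1..1::real} x \<partial>lborel) = ennreal 2"
    by (simp add: nn_integral_indicator)
  ultimately have fin: "(\<integral>\<^sup>+x. indicator {-1..1} x + (ennreal (g x) + ennreal (g (- x))) \<partial>lborel) < top"
    by (simp add: nn_integral_add)
  have "ennreal (cmod (Complex x 1) powr (- s)) \<le> indicator {-1..1} x + (ennreal (g x) + ennreal (g (- x)))" for x
  proof -
    have "cmod (Complex x 1) powr (- s) \<le> indicator {-1..1} x + (g x + g (- x))"
    proof (cases "\<bar>x\<bar> \<le> 1")
      case True
      have "1 \<le> cmod (Complex x 1)" using abs_Im_le_cmod[of "Complex x 1"] by simp
      then have "cmod (Complex x 1) powr (- s) \<le> 1 powr (- s)"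
        using s by (intro powr_mono2') auto
      moreover have "0 \<le> g x" "0 \<le> g (- x)" by (auto simp: g_def)
      ultimately show ?thesis using True by (auto simp: indicator_def)
    next
      case False
      have "\<bar>x\<bar> \<le> cmod (Complex x 1)" using abs_Re_le_cmod[of "Complex x 1"] by simp
      then have "cmod (Complex x 1) powr (- s) \<le> \<bar>x\<bar> powr (- s)"
        using s False by (intro powr_mono2') auto
      also have "\<dots> \<le> g x + g (- x)" using False by (auto simp: g_def indicator_def)
      finally show ?thesis by (simp add: add_increasing)
    qed
    moreover have "0 \<le> g x" "0 \<le> g (- x)" by (auto simp: g_def)
    ultimately show ?thesis
      by (auto simp: indicator_def simp flip: ennreal_plus intro: ennreal_leI split: if_splits)
         (metis add_nonneg_nonneg ennreal_1 ennreal_leI ennreal_plus zero_le_one)+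
  qed
  then have "(\<integral>\<^sup>+x. ennreal (cmod (Complex x 1) powr (- s)) \<partial>lborel)
      \<le> (\<integral>\<^sup>+x. indicator {-1..1} x + (ennreal (g x) + ennreal (g (- x))) \<partial>lborel)"
    by (rule nn_integral_mono)
  then show ?thesis using fin by (rule le_less_trans)
qed

lemma line_integral_le_of_decay:
  assumes p: "0 < p" and M: "0 \<le> M" and y: "0 < y"
    and decay: "\<And>z. z \<in> upper_half_plane \<Longrightarrow> cmod (R z) \<le> M / cmod (z + \<i>) ^ m"
  shows "line_integral_powr p R y
    \<le> ennreal (M powr p) * (\<integral>\<^sup>+x. ennreal (cmod (Complex x 1) powr (- (real m * p))) \<partial>lborel)"
proof -
  have "cmod (R (Complex x y)) powr p \<le> M powr p * cmod (Complex x 1) powr (- (real m * p))" for x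
  proof -
    have pos: "0 < cmod (Complex x 1)" by (simp add: complex_eq_iff)
    have "cmod (Complex x 1) \<le> cmod (Complex x y + \<i>)"
      using y by (simp add: cmod_def power_mono)
    then have "M / cmod (Complex x y + \<i>) ^ m \<le> M / cmod (Complex x 1) ^ m"
      using M pos by (intro divide_left_mono power_mono mult_pos_pos zero_less_power) auto
    then have "cmod (R (Complex x y)) \<le> M / cmod (Complex x 1) ^ m"
      using decay[of "Complex x y"] y by (force simp: upper_half_plane_def)
    then have "cmod (R (Complex x y)) powr p \<le> (M / cmod (Complex x 1) ^ m) powr p"
      using p by (intro powr_mono2) auto
    also have "\<dots> = M powr p * cmod (Complex x 1) powr (- (real m * p))"
    proof -
      have a: "(cmod (Complex x 1) ^ m) powr p = cmod (Complex x 1) powr (real m * p)"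
        using pos by (simp add: powr_powr flip: powr_realpow)
      have b: "(M / cmod (Complex x 1) ^ m) powr p = M powr p / (cmod (Complex x 1) ^ m) powr p"
        by (rule powr_divide)
      show ?thesis unfolding b a by (simp add: powr_minus_divide)
    qed
    finally show ?thesis .
  qed
  then have "line_integral_powr p R y
    \<le> (\<integral>\<^sup>+x. ennreal (M powr p) * ennreal (cmod (Complex x 1) powr (- (real m * p))) \<partial>lborel)"
    unfolding line_integral_powr_def by (intro nn_integral_mono) (simp flip: ennreal_mult)
  also have "\<dots> = ennreal (M powr p) * (\<integral>\<^sup>+x. ennreal (cmod (Complex x 1) powr (- (real m * p))) \<partial>lborel)"
  proof (rule nn_integral_cmult)
    have "continuous_on UNIV (\<lambda>x. cmod (Complex x 1) powr (- (real m * p)))"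
      unfolding Complex_eq by (intro continuous_intros) (auto simp: complex_eq_iff)
    from borel_measurable_continuous_onI[OF this]
    show "(\<lambda>x. ennreal (cmod (Complex x 1) powr (- (real m * p)))) \<in> borel_measurable lborel" by simp
  qed
  finally show ?thesis .
qed

section \<open>Rational approximation of decaying functions\<close>

text \<open>A dilate of \<open>G\<close> is close to \<open>G\<close> by uniform continuity and is holomorphic on a larger disc, so its
Taylor series converges uniformly on the closed unit disc.\<close>

lemma disc_algebra_polynomial_approx:
  assumes cont: "continuous_on (cball 0 1) G" and hol: "G holomorphic_on ball 0 1" and e: "0 < e"
  obtains P :: "complex poly" where "\<And>w. cmod w \<le> 1 \<Longrightarrow> cmod (G w - poly P w) \<le> e"
proof -
  have "uniformly_continuous_on (cball 0 1) G"
    by (rule compact_uniformly_continuous[OF cont]) simp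
  then obtain d where d: "0 < d" "\<And>x x'. x \<in> cball 0 1 \<Longrightarrow> x' \<in> cball 0 1 \<Longrightarrow> dist x' x < d \<Longrightarrow> dist (G x') (G x) < e / 2"
    using e unfolding uniformly_continuous_on_def by (metis half_gt_zero)
  define r where "r = max (1 / 2) (1 - d / 2)"
  have r: "0 < r" "r < 1" "1 - r < d" using d(1) by (auto simp: r_def)
  have dilate: "cmod (G w - G (r * w)) \<le> e / 2" if w: "cmod w \<le> 1" for w :: complex
  proof -
    have "cmod (r * w) \<le> 1" using r w by (simp add: norm_mult mult_le_one)
    moreover have "dist w (r * w) < d"
    proof -
      have "w - r * w = of_real (1 - r) * w" by (simp add: algebra_simps)
      then have "dist w (r * w) = (1 - r) * cmod w" using r by (simp add: dist_norm norm_mult del: of_real_diff)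
      also have "\<dots> \<le> (1 - r) * 1" using r w by (intro mult_left_mono) auto
      finally show ?thesis using r by simp
    qed
    ultimately show ?thesis using d(2)[of "r * w" w] w by (simp add: dist_norm)
  qed
  define H where "H w = G (r * w)" for w :: complex
  have "(\<lambda>w::complex. of_real r * w) ` ball 0 (1 / r) \<subseteq> ball 0 1"
    using r by (auto simp: norm_mult field_simps simp flip: norm_conv_dist)
  then have H_hol: "H holomorphic_on ball 0 (1 / r)"
    using holomorphic_on_compose_gen[OF _ hol, of "\<lambda>w. of_real r * w" "ball 0 (1 / r)"]
    by (simp add: o_def H_def[abs_def] holomorphic_intros)
  define c where "c n = (deriv ^^ n) H 0 / fact n" for n
  have c_sums: "(\<lambda>n. c n * w ^ n) sums H w" if "w \<in> ball 0 (1 / r)" for w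
    using holomorphic_power_series[OF H_hol that] by (simp add: c_def)
  define \<rho> where "\<rho> = (1 + 1 / r) / 2"
  have \<rho>: "1 < \<rho>" "\<rho> < 1 / r" using r by (auto simp: \<rho>_def field_simps)
  have "summable (\<lambda>n. c n * of_real \<rho> ^ n)"
    using c_sums[of "of_real \<rho>"] \<rho> by (simp add: sums_iff)
  from powser_insidea[OF this, of 1] have c_summable: "summable (\<lambda>n. cmod (c n))"
    using \<rho> by simp
  obtain m where m: "norm (\<Sum>i. cmod (c (i + m))) < e / 2"
    using suminf_exist_split[OF half_gt_zero[OF e] c_summable] by blast
  define P where "P = (\<Sum>n<m. monom (c n) n)"
  have tail: "cmod (H w - poly P w) \<le> e / 2" if w: "cmod w \<le> 1" for w :: complex
  proof -
    have win: "w \<in> ball 0 (1 / r)" using w \<rho> by simp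
    have le: "cmod (c (i + m) * w ^ (i + m)) \<le> cmod (c (i + m))" for i
      using w by (simp add: norm_mult norm_power mult_left_le power_le_one)
    have sm: "summable (\<lambda>i. cmod (c (i + m)))" by (rule summable_ignore_initial_segment[OF c_summable])
    have "H w - poly P w = (\<Sum>i. c (i + m) * w ^ (i + m))"
      using suminf_minus_initial_segment[of "\<lambda>n. c n * w ^ n" m] c_sums[OF win]
      by (simp add: P_def poly_sum poly_monom sums_iff)
    also have "cmod \<dots> \<le> (\<Sum>i. cmod (c (i + m)))"
      by (rule norm_suminf_le[OF le sm])
    finally show ?thesis using m by simp
  qed
  show thesis
  proof (rule that)
    fix w :: complex assume w: "cmod w \<le> 1"
    have "G w - poly P w = (G w - G (r * w)) + (H w - poly P w)" by (simp add: H_def)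
    then show "cmod (G w - poly P w) \<le> e"
      using norm_triangle_ineq[of "G w - G (r * w)" "H w - poly P w"] dilate[OF w] tail[OF w] by simp
  qed
qed

lemma rational_class_iff:
  "g \<in> rational_class N \<longleftrightarrow> (\<exists>P. g = (\<lambda>z. poly P (inverse (z + \<i>)) / (z + \<i>) ^ (N + 1)))"
proof -
  have "- int N - 1 = - int (N + 1)" by simp
  then have "z powi (- int N - 1) * a = a / z ^ (N + 1)" for z a :: complex
    by (simp only: power_int_minus power_int_of_nat divide_inverse mult.commute)
  then show ?thesis unfolding rational_class_def by simp
qed

lemma add_i_upper_half_plane:
  assumes "0 \<le> Im z"
  shows "z + \<i> \<noteq> 0" and "1 \<le> cmod (z + \<i>)"
  using assms abs_Im_le_cmod[of "z + \<i>"] by (auto simp: complex_eq_iff)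

lemma rational_class_decay:
  assumes "g \<in> rational_class N"
  obtains M where "0 \<le> M" "\<And>z. z \<in> upper_half_plane \<Longrightarrow> cmod (g z) \<le> M / cmod (z + \<i>) ^ (N + 1)"
proof -
  obtain P where g: "g = (\<lambda>z. poly P (inverse (z + \<i>)) / (z + \<i>) ^ (N + 1))"
    using assms by (auto simp: rational_class_iff)
  have "bounded (poly P ` cball 0 1)"
    by (intro compact_imp_bounded compact_continuous_image continuous_intros) simp
  then obtain M where "\<forall>x\<in>poly P ` cball 0 1. cmod x \<le> M"
    unfolding bounded_iff by blast
  then have M: "cmod (poly P w) \<le> M" if "cmod w \<le> 1" for w
    using that by simp
  show thesis
  proof (rule that)
    show "0 \<le> M" using M[of 0] norm_ge_zero order_trans by (metis norm_zero zero_le_one)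
    fix z assume z: "z \<in> upper_half_plane"
    then have "cmod (inverse (z + \<i>)) \<le> 1"
      using add_i_upper_half_plane[of z] by (simp add: upper_half_plane_def norm_inverse inverse_le_1_iff)
    then show "cmod (g z) \<le> M / cmod (z + \<i>) ^ (N + 1)"
      unfolding g norm_divide norm_power by (intro divide_right_mono M) auto
  qed
qed

lemma rational_class_subset_hardy_space:
  assumes p: "0 < p" and Np: "1 < real (N + 1) * p"
  shows "rational_class N \<subseteq> hardy_space p"
proof
  fix g assume g: "g \<in> rational_class N"
  then obtain P where P: "g = (\<lambda>z. poly P (inverse (z + \<i>)) / (z + \<i>) ^ (N + 1))"
    by (auto simp: rational_class_iff)
  have "g holomorphic_on upper_half_plane"
    unfolding P using add_i_upper_half_plane
    by (intro holomorphic_intros) (auto simp: upper_half_plane_def)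
  obtain M where M: "0 \<le> M" "\<And>z. z \<in> upper_half_plane \<Longrightarrow> cmod (g z) \<le> M / cmod (z + \<i>) ^ (N + 1)"
    using rational_class_decay[OF g] by blast
  define I where "I = (\<integral>\<^sup>+x. ennreal (cmod (Complex x 1) powr (- (real (N + 1) * p))) \<partial>lborel)"
  have "ennreal (M powr p) * I < top"
    unfolding I_def using nn_integral_Complex_powr_finite[OF Np] by (simp add: ennreal_mult_less_top)
  then obtain K where K: "ennreal (M powr p) * I = ennreal K"
    by (cases "ennreal (M powr p) * I") auto
  have "line_integral_powr p g y \<le> ennreal K" if "0 < y" for y
    using line_integral_le_of_decay[OF p M(1) that M(2)] by (simp add: K[symmetric] I_def)
  then show "g \<in> hardy_space p"
    using \<open>g holomorphic_on upper_half_plane\<close> hardy_space_iff[OF p] by blast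
qed

text \<open>In the coordinate \<open>w = (z - \<i>) / (z + \<i>)\<close> of the unit disc, \<open>inverse (z + \<i>)\<close> is affine in \<open>w\<close>. The
function \<open>(z + \<i>) ^ (N + 1) * F z\<close> of \<open>w\<close> belongs to the disc algebra: one power of decay to spare makes
it vanish at \<open>w = 1\<close>, the point that corresponds to infinity. Approximate it by a polynomial in \<open>w\<close>.\<close>

lemma rational_class_approx_of_decay:
  assumes cont: "continuous_on {z. 0 \<le> Im z} F" and hol: "F holomorphic_on upper_half_plane"
    and decay: "\<And>z. 0 \<le> Im z \<Longrightarrow> cmod (F z) \<le> C / cmod (z + \<i>) ^ (N + 2)"
    and e: "0 < e"
  obtains g where "g \<in> rational_class N"
    "\<And>z. z \<in> upper_half_plane \<Longrightarrow> cmod (F z - g z) \<le> e / cmod (z + \<i>) ^ (N + 1)"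
proof -
  define \<kappa> where "\<kappa> w = \<i> * ((1 + w) / (1 - w))" for w :: complex
  define G where "G w = (if w = 1 then 0 else (\<kappa> w + \<i>) ^ (N + 1) * F (\<kappa> w))" for w
  have Im_\<kappa>: "Im (\<kappa> w) = (1 - (cmod w)\<^sup>2) / (cmod (1 - w))\<^sup>2" if "w \<noteq> 1" for w
    unfolding \<kappa>_def Re_Cayley[OF that, symmetric] by (simp only: Im_i_times)
  have \<kappa>_closed: "0 \<le> Im (\<kappa> w)" if "cmod w \<le> 1" "w \<noteq> 1" for w
    unfolding Im_\<kappa>[OF that(2)] using that by (simp add: power_le_one)
  have \<kappa>_open: "\<kappa> w \<in> upper_half_plane" if "cmod w < 1" for w
  proof -
    have "w \<noteq> 1" using that by auto
    moreover have "(cmod w)\<^sup>2 < 1" using that by (simp add: power_less_one_iff abs_square_less_1)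
    ultimately show ?thesis by (simp add: upper_half_plane_def Im_\<kappa>)
  qed
  have \<kappa>_plus_i: "\<kappa> w + \<i> = 2 * \<i> / (1 - w)" if "w \<noteq> 1" for w
    using that by (simp add: \<kappa>_def field_simps)
  have G_le: "cmod (G w) \<le> \<bar>C\<bar> * cmod (1 - w)" if w: "cmod w \<le> 1" for w
  proof (cases "w = 1")
    case False
    define k where "k = cmod (\<kappa> w + \<i>)"
    have k: "1 \<le> k" using add_i_upper_half_plane(2)[OF \<kappa>_closed[OF w False]] by (simp add: k_def)
    have "cmod (G w) = k ^ (N + 1) * cmod (F (\<kappa> w))"
      using False by (simp add: G_def norm_mult norm_power k_def)
    also have "\<dots> \<le> k ^ (N + 1) * (C / k ^ (N + 2))"
      using decay[OF \<kappa>_closed[OF w False]] k by (intro mult_left_mono) (auto simp: k_def)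
    also have "\<dots> = C / k" using k by simp
    also have "\<dots> = C * (cmod (1 - w) / 2)"
      using False unfolding k_def \<kappa>_plus_i[OF False] by (simp add: norm_divide norm_mult)
    also have "\<dots> \<le> \<bar>C\<bar> * cmod (1 - w)"
      by (intro mult_mono) auto
    finally show ?thesis .
  qed (simp add: G_def)
  have contG: "continuous_on (cball 0 1) G"
    unfolding continuous_on_eq_continuous_within
  proof
    fix w :: complex assume w: "w \<in> cball 0 1"
    show "continuous (at w within cball 0 1) G"
    proof (cases "w = 1")
      case True
      have "(G \<longlongrightarrow> 0) (at 1 within cball 0 1)"
      proof (rule Lim_null_comparison)
        show "\<forall>\<^sub>F w in at 1 within cball 0 1. norm (G w) \<le> \<bar>C\<bar> * cmod (1 - w)"
          using G_le by (auto simp: eventually_at_filter)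
        have "((\<lambda>w. \<bar>C\<bar> * cmod (1 - w)) \<longlongrightarrow> \<bar>C\<bar> * cmod (1 - 1)) (at 1 within cball (0::complex) 1)"
          by (intro tendsto_intros)
        then show "((\<lambda>w. \<bar>C\<bar> * cmod (1 - w)) \<longlongrightarrow> 0) (at 1 within cball (0::complex) 1)" by simp
      qed
      then show ?thesis by (simp add: True continuous_within G_def)
    next
      case False
      have k: "continuous_on (cball 0 1 - {1}) \<kappa>"
        unfolding \<kappa>_def by (intro continuous_intros) auto
      then have "continuous_on (cball 0 1 - {1}) (\<lambda>w. F (\<kappa> w))"
        by (rule continuous_on_compose2[OF cont]) (use \<kappa>_closed in auto)
      then have "continuous_on (cball 0 1 - {1}) (\<lambda>w. (\<kappa> w + \<i>) ^ (N + 1) * F (\<kappa> w))"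
        by (intro continuous_intros k)
      then have "continuous_on (cball 0 1 - {1}) G"
        by (rule continuous_on_eq) (auto simp: G_def)
      then have "continuous (at w within cball 0 1 - {1}) G"
        using w False by (auto simp: continuous_on_eq_continuous_within)
      moreover have "at w within (cball 0 1 - {1}) = at w within (cball 0 1)"
        using False by (intro at_within_nhd[of _ "- {1}"]) auto
      ultimately show ?thesis by simp
    qed
  qed
  have holG: "G holomorphic_on ball 0 1"
  proof -
    have k: "\<kappa> holomorphic_on ball 0 1"
      unfolding \<kappa>_def by (intro holomorphic_intros) auto
    have "\<kappa> ` ball 0 1 \<subseteq> upper_half_plane" using \<kappa>_open by auto
    with k have "(\<lambda>w. F (\<kappa> w)) holomorphic_on ball 0 1"
      using holomorphic_on_compose_gen[OF _ hol] by (simp add: o_def)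
    then have "(\<lambda>w. (\<kappa> w + \<i>) ^ (N + 1) * F (\<kappa> w)) holomorphic_on ball 0 1"
      by (intro holomorphic_intros k)
    then show ?thesis
      by (rule holomorphic_transform) (auto simp: G_def)
  qed
  obtain P where P: "\<And>w. cmod w \<le> 1 \<Longrightarrow> cmod (G w - poly P w) \<le> e"
    using disc_algebra_polynomial_approx[OF contG holG e] by blast
  define g where "g z = poly (P \<circ>\<^sub>p [:1, - 2 * \<i>:]) (inverse (z + \<i>)) / (z + \<i>) ^ (N + 1)" for z
  show thesis
  proof (rule that)
    show "g \<in> rational_class N"
      unfolding rational_class_iff g_def[abs_def] by blast
    fix z assume "z \<in> upper_half_plane"
    then have z: "0 < Im z" by (simp add: upper_half_plane_def)
    define w where "w = (z - \<i>) / (z + \<i>)"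
    have nz: "z + \<i> \<noteq> 0" using add_i_upper_half_plane(1)[of z] z by simp
    have "cmod (z - \<i>) \<le> cmod (z + \<i>)"
      using z by (simp add: cmod_def power2_eq_square algebra_simps)
    then have w_le: "cmod w \<le> 1" using nz by (simp add: w_def norm_divide)
    have one_minus: "1 - w = 2 * \<i> * inverse (z + \<i>)" using nz by (simp add: w_def field_simps)
    then have w1: "w \<noteq> 1" using nz by auto
    have "\<kappa> w = z"
    proof -
      have "2 * \<i> / (2 * \<i> * inverse u) = u" for u
        by (cases "u = 0") (simp_all add: field_simps)
      then have "\<kappa> w + \<i> = z + \<i>" unfolding \<kappa>_plus_i[OF w1] one_minus .
      then show ?thesis by simp
    qed
    then have "G w = (z + \<i>) ^ (N + 1) * F z" using w1 by (simp add: G_def)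
    moreover have "w = 1 + (- 2 * \<i>) * inverse (z + \<i>)" using one_minus by (simp add: algebra_simps)
    then have "poly P w = (z + \<i>) ^ (N + 1) * g z"
      using nz by (simp add: g_def poly_pcompose mult.commute)
    ultimately have "cmod ((z + \<i>) ^ (N + 1) * (F z - g z)) \<le> e"
      using P[OF w_le] by (simp only: right_diff_distrib)
    moreover have "0 < cmod (z + \<i>) ^ (N + 1)" using nz by simp
    ultimately show "cmod (F z - g z) \<le> e / cmod (z + \<i>) ^ (N + 1)"
      by (simp add: norm_mult norm_power pos_le_divide_eq mult.commute del: power_Suc)
  qed
qed

section \<open>Creating decay at infinity\<close>

text \<open>A bounded holomorphic factor that tends to \<open>1\<close> pointwise as \<open>\<eta>\<close> tends to \<open>0\<close>, and decays at infinity for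
each \<open>\<eta> > 0\<close>.\<close>

definition cutoff :: "real \<Rightarrow> complex \<Rightarrow> complex" where
  "cutoff \<eta> z = inverse (1 - \<i> * of_real \<eta> * z)"

lemma cutoff_denominator:
  assumes "0 \<le> \<eta>" and "0 \<le> Im z"
  shows "1 \<le> cmod (1 - \<i> * of_real \<eta> * z)" and "1 - \<i> * of_real \<eta> * z \<noteq> 0"
proof -
  have "1 \<le> Re (1 - \<i> * of_real \<eta> * z)" using assms by simp
  then show "1 \<le> cmod (1 - \<i> * of_real \<eta> * z)"
    using complex_Re_le_cmod order_trans by blast
  then show "1 - \<i> * of_real \<eta> * z \<noteq> 0" by auto
qed

lemma norm_cutoff_le_1:
  assumes "0 \<le> \<eta>" and "0 \<le> Im z"
  shows "cmod (cutoff \<eta> z) \<le> 1"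
  using cutoff_denominator(1)[OF assms] by (simp add: cutoff_def norm_inverse inverse_le_1_iff)

lemma norm_cutoff_le:
  assumes "0 < \<eta>" "\<eta> \<le> 1" and z: "0 \<le> Im z"
  shows "cmod (cutoff \<eta> z) \<le> 1 / (\<eta> * cmod (z + \<i>))"
proof -
  have "1 - \<i> * of_real \<eta> * z = - \<i> * of_real \<eta> * (z + \<i> * of_real (1 / \<eta>))"
    using assms by (simp add: field_simps)
  then have "cmod (1 - \<i> * of_real \<eta> * z) = \<eta> * cmod (z + \<i> * of_real (1 / \<eta>))"
    using assms by (simp add: norm_mult)
  moreover have "cmod (z + \<i>) \<le> cmod (z + \<i> * of_real (1 / \<eta>))"
  proof -
    have "1 \<le> 1 / \<eta>" using assms by simp
    then have "(Im z + 1)\<^sup>2 \<le> (Im z + 1 / \<eta>)\<^sup>2" using z by (intro power_mono) auto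
    then show ?thesis by (simp add: cmod_def)
  qed
  ultimately have "\<eta> * cmod (z + \<i>) \<le> cmod (1 - \<i> * of_real \<eta> * z)" using assms by simp
  moreover have "0 < \<eta> * cmod (z + \<i>)" using assms add_i_upper_half_plane(1)[OF z] by simp
  ultimately show ?thesis
    by (simp add: cutoff_def norm_inverse divide_inverse le_imp_inverse_le del: inverse_mult_distrib)
qed

lemma cutoff_holomorphic:
  assumes "0 \<le> \<eta>"
  shows "cutoff \<eta> holomorphic_on {z. 0 \<le> Im z}"
  unfolding cutoff_def[abs_def] using cutoff_denominator(2)[OF assms] by (intro holomorphic_intros) auto

text \<open>Dominated convergence on the single line of height \<open>h\<close>, spread to all higher lines by monotonicity.\<close>

lemma line_integral_cutoff_le:
  assumes hol: "F holomorphic_on upper_half_plane" and p: "0 < p"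
    and A: "\<And>y. 0 < y \<Longrightarrow> line_integral_powr p F y \<le> A" "A < top"
    and h: "0 < h" and \<epsilon>: "0 < \<epsilon>"
  obtains \<eta> where "0 < \<eta>" "\<eta> \<le> 1"
    "\<And>y. h \<le> y \<Longrightarrow> line_integral_powr p (\<lambda>z. F z * (1 - cutoff \<eta> z ^ M)) y \<le> ennreal \<epsilon>"
proof -
  have contF: "continuous_on upper_half_plane F"
    by (rule holomorphic_on_imp_continuous_on[OF hol])
  define V where "V \<eta> z = F z * (1 - cutoff \<eta> z ^ M)" for \<eta> z
  have V_hol: "V \<eta> holomorphic_on upper_half_plane" if "0 \<le> \<eta>" for \<eta>
    unfolding V_def[abs_def]
    by (intro holomorphic_intros hol holomorphic_on_subset[OF cutoff_holomorphic[OF that]])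
       (auto simp: upper_half_plane_def)
  have V_le: "cmod (V \<eta> z) powr p \<le> 2 powr p * cmod (F z) powr p" if "0 \<le> \<eta>" "0 < Im z" for \<eta> z
  proof -
    have "cmod (cutoff \<eta> z ^ M) \<le> 1"
      using norm_cutoff_le_1[of \<eta> z] that by (simp add: norm_power power_le_one)
    then have "cmod (1 - cutoff \<eta> z ^ M) \<le> 2"
      using norm_triangle_ineq4[of 1 "cutoff \<eta> z ^ M"] by simp
    then have "cmod (V \<eta> z) \<le> cmod (F z) * 2"
      unfolding V_def norm_mult by (intro mult_left_mono) auto
    then have "cmod (V \<eta> z) powr p \<le> (cmod (F z) * 2) powr p" using p by (intro powr_mono2) auto
    then show ?thesis by (simp add: powr_mult mult.commute)
  qed
  have V_bound: "line_integral_powr p (V \<eta>) y \<le> ennreal (2 powr p) * A" if "0 \<le> \<eta>" "0 < y" for \<eta> y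
  proof -
    have "line_integral_powr p (V \<eta>) y \<le> (\<integral>\<^sup>+x. ennreal (2 powr p) * ennreal (cmod (F (Complex x y)) powr p) \<partial>lborel)"
      unfolding line_integral_powr_def
      by (intro nn_integral_mono) (use V_le that in \<open>simp flip: ennreal_mult\<close>)
    also have "\<dots> = ennreal (2 powr p) * line_integral_powr p F y"
      unfolding line_integral_powr_def
      using borel_measurable_horizontal_powr[OF contF that(2) p] by (intro nn_integral_cmult) simp
    also have "\<dots> \<le> ennreal (2 powr p) * A" using that by (intro mult_left_mono A) auto
    finally show ?thesis .
  qed
  have "(\<lambda>n. line_integral_powr p (V (1 / real (Suc n))) h) \<longlonglongrightarrow> (\<integral>\<^sup>+x. 0 \<partial>(lborel :: real measure))"
    unfolding line_integral_powr_def
  proof (rule nn_integral_dominated_convergence[where w = "\<lambda>x. ennreal (2 powr p * cmod (F (Complex x h)) powr p)"])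
    show "(\<lambda>x. ennreal (cmod (V (1 / real (Suc n)) (Complex x h)) powr p)) \<in> borel_measurable lborel" for n
      using borel_measurable_horizontal_powr[OF holomorphic_on_imp_continuous_on[OF V_hol] h p] by simp
    show "(\<lambda>x. ennreal (2 powr p * cmod (F (Complex x h)) powr p)) \<in> borel_measurable lborel"
      using borel_measurable_horizontal_powr[OF contF h p] by simp
    show "AE x in lborel. ennreal (cmod (V (1 / real (Suc n)) (Complex x h)) powr p)
        \<le> ennreal (2 powr p * cmod (F (Complex x h)) powr p)" for n
      using V_le h by (intro AE_I2 ennreal_leI) simp
    have "(\<integral>\<^sup>+x. ennreal (2 powr p * cmod (F (Complex x h)) powr p) \<partial>lborel)
        = ennreal (2 powr p) * line_integral_powr p F h"
      unfolding line_integral_powr_def using borel_measurable_horizontal_powr[OF contF h p]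
      by (simp add: ennreal_mult nn_integral_cmult)
    also have "\<dots> < \<infinity>" using A(1)[OF h] A(2) by (auto simp: ennreal_mult_less_top intro: le_less_trans)
    finally show "(\<integral>\<^sup>+x. ennreal (2 powr p * cmod (F (Complex x h)) powr p) \<partial>lborel) < \<infinity>" .
    have "(\<lambda>n. ennreal (cmod (V (1 / real (Suc n)) z) powr p)) \<longlonglongrightarrow> 0" for z
    proof -
      have "(\<lambda>n. 1 / real (Suc n)) \<longlonglongrightarrow> 0" by (rule LIMSEQ_Suc[OF lim_1_over_n])
      then have "(\<lambda>n. V (1 / real (Suc n)) z) \<longlonglongrightarrow> F z * (1 - inverse (1 - \<i> * of_real 0 * z) ^ M)"
        unfolding V_def cutoff_def by (intro tendsto_intros) auto
      then have "(\<lambda>n. cmod (V (1 / real (Suc n)) z) powr p) \<longlonglongrightarrow> cmod 0 powr p"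
        using p by (intro tendsto_powr2 tendsto_norm) auto
      then show ?thesis using tendsto_ennrealI by fastforce
    qed
    then show "AE x in lborel. (\<lambda>n. ennreal (cmod (V (1 / real (Suc n)) (Complex x h)) powr p)) \<longlonglongrightarrow> 0"
      by simp
  qed simp
  then have "\<forall>\<^sub>F n in sequentially. line_integral_powr p (V (1 / real (Suc n))) h < ennreal \<epsilon>"
    using \<epsilon> by (intro order_tendstoD) auto
  then obtain n where n: "line_integral_powr p (V (1 / real (Suc n))) h < ennreal \<epsilon>"
    by (auto simp: eventually_sequentially)
  show thesis
  proof (rule that)
    show "0 < 1 / real (Suc n)" "1 / real (Suc n) \<le> 1" by auto
    fix y assume y: "h \<le> y"
    have "line_integral_powr p (V (1 / real (Suc n))) y \<le> line_integral_powr p (V (1 / real (Suc n))) h"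
      by (rule line_integral_antimono[OF V_hol p V_bound _ h y])
         (use A(2) in \<open>auto simp: ennreal_mult_less_top\<close>)
    then show "line_integral_powr p (\<lambda>z. F z * (1 - cutoff (1 / real (Suc n)) z ^ M)) y \<le> ennreal \<epsilon>"
      using n by (simp add: V_def[abs_def])
  qed
qed

section \<open>Density\<close>

text \<open>Three approximations in succession: translate \<open>f\<close> upwards, which makes it bounded and continuous up to
the boundary; multiply by a power of the cutoff to create decay; replace the result by a rational
function. The last error is pointwise at most a small multiple of the modulus of \<open>(z + \<i>)\<close> to
the power \<open>- (N + 1)\<close>, and the \<open>p\<close>-th power of this is integrable over lines.\<close>

lemma rational_class_approx:
  assumes p: "0 < p" and Np: "1 < real (N + 1) * p" and f: "f \<in> hardy_space p" and \<epsilon>: "0 < \<epsilon>"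
  obtains g where "g \<in> rational_class N"
    "\<And>y. 0 < y \<Longrightarrow> line_integral_powr p (\<lambda>z. f z - g z) y \<le> ennreal \<epsilon>"
proof -
  obtain K where hol: "f holomorphic_on upper_half_plane"
    and K: "\<And>y. 0 < y \<Longrightarrow> line_integral_powr p f y \<le> ennreal K"
    using f hardy_space_iff[OF p] by blast
  \<comment> \<open>Each of the two additions of errors costs a factor \<open>2 powr p\<close>, the constant in the triangle
    inequality for \<open>p\<close>-th powers.\<close>
  define e where "e = \<epsilon> / (3 * (2 powr p * 2 powr p))"
  have e: "0 < e" using \<epsilon> by (simp add: e_def)
  obtain h where h: "0 < h" and translate:
    "\<And>y. 0 < y \<Longrightarrow> line_integral_powr p (\<lambda>z. f z - f (z + \<i> * of_real h)) y \<le> ennreal e"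
    using line_integral_translation_small[OF hol p K _ e] by auto
  obtain \<eta> where \<eta>: "0 < \<eta>" "\<eta> \<le> 1" and cut:
    "\<And>y. h \<le> y \<Longrightarrow> line_integral_powr p (\<lambda>z. f z * (1 - cutoff \<eta> z ^ (N + 2))) y \<le> ennreal e"
    using line_integral_cutoff_le[OF hol p K ennreal_less_top h e, where M = "N + 2"] by blast
  define F where "F z = f (z + \<i> * of_real h) * cutoff \<eta> (z + \<i> * of_real h) ^ (N + 2)" for z
  have shift_hol: "(\<lambda>z. z + \<i> * of_real h) holomorphic_on S" for S
    by (intro holomorphic_intros)
  have shift_f: "(\<lambda>z. f (z + \<i> * of_real h)) holomorphic_on {z. 0 \<le> Im z}"
    using holomorphic_on_compose_gen[OF shift_hol hol, of "{z. 0 \<le> Im z}"] h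
    by (force simp: o_def upper_half_plane_def)
  have shift_cutoff: "(\<lambda>z. cutoff \<eta> (z + \<i> * of_real h)) holomorphic_on {z. 0 \<le> Im z}"
    using holomorphic_on_compose_gen[OF shift_hol cutoff_holomorphic, of \<eta> "{z. 0 \<le> Im z}"] h \<eta>
    by (force simp: o_def)
  have F_hol: "F holomorphic_on {z. 0 \<le> Im z}"
    unfolding F_def[abs_def] by (intro holomorphic_intros shift_f shift_cutoff)
  obtain B where B: "0 \<le> B" "\<And>z. h \<le> Im z \<Longrightarrow> cmod (f z) \<le> B"
  proof -
    have "cmod (f z) \<le> (max K 0 / (h / 3)) powr (1 / p)" if z: "h \<le> Im z" for z
    proof -
      \<comment> \<open>The pointwise bound is applied with \<open>\<rho> = h / 3\<close>, so that \<open>2 * \<rho> < Im z\<close>.\<close>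
      have "ennreal (h / 3 * cmod (f z) powr p) \<le> ennreal (max K 0)"
        by (rule powr_norm_le_of_line_integral_bound[OF hol p])
           (use h z in \<open>auto intro: order_trans[OF K ennreal_leI]\<close>)
      then have "h / 3 * cmod (f z) powr p \<le> max K 0" by (simp add: ennreal_le_iff)
      then have "cmod (f z) powr p \<le> max K 0 / (h / 3)" using h by (simp add: field_simps)
      then have "(cmod (f z) powr p) powr (1 / p) \<le> (max K 0 / (h / 3)) powr (1 / p)"
        using p by (intro powr_mono2) auto
      then show ?thesis using p by (simp add: powr_powr)
    qed
    then show thesis using that[of "(max K 0 / (h / 3)) powr (1 / p)"] by simp
  qed
  have F_decay: "cmod (F z) \<le> B / \<eta> ^ (N + 2) / cmod (z + \<i>) ^ (N + 2)" if z: "0 \<le> Im z" for z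
  proof -
    have zh: "0 \<le> Im (z + \<i> * of_real h)" using z h by simp
    have "cmod (cutoff \<eta> (z + \<i> * of_real h)) \<le> 1 / (\<eta> * cmod (z + \<i> * of_real h + \<i>))"
      by (rule norm_cutoff_le[OF \<eta> zh])
    also have "\<dots> \<le> 1 / (\<eta> * cmod (z + \<i>))"
    proof -
      have "(Im z + 1)\<^sup>2 \<le> (Im z + h + 1)\<^sup>2" using z h by (intro power_mono) auto
      then have "cmod (z + \<i>) \<le> cmod (z + \<i> * of_real h + \<i>)" by (simp add: cmod_def)
      moreover have "0 < cmod (z + \<i>)" using add_i_upper_half_plane(2)[OF z] by linarith
      ultimately show ?thesis using \<eta> by (intro divide_left_mono mult_left_mono mult_pos_pos) auto
    qed
    finally have "cmod (cutoff \<eta> (z + \<i> * of_real h)) ^ (N + 2) \<le> (1 / (\<eta> * cmod (z + \<i>))) ^ (N + 2)"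
      by (intro power_mono) auto
    then have "cmod (F z) \<le> B * (1 / (\<eta> * cmod (z + \<i>))) ^ (N + 2)"
      unfolding F_def norm_mult norm_power using B z by (intro mult_mono) auto
    then show ?thesis by (simp add: power_divide power_mult_distrib del: power_Suc)
  qed
  define W where "W = (\<integral>\<^sup>+x. ennreal (cmod (Complex x 1) powr (- (real (N + 1) * p))) \<partial>lborel)"
  obtain w where w: "W = ennreal w" "0 \<le> w"
    using nn_integral_Complex_powr_finite[OF Np] unfolding W_def[symmetric] by (cases W) auto
  define e' where "e' = (e / (w + 1)) powr (1 / p)"
  have e': "0 < e'" "e' powr p * w \<le> e"
    using e w p by (auto simp: e'_def powr_powr field_simps)
  obtain g where g: "g \<in> rational_class N"
    "\<And>z. z \<in> upper_half_plane \<Longrightarrow> cmod (F z - g z) \<le> e' / cmod (z + \<i>) ^ (N + 1)"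
  proof -
    have "continuous_on {z. 0 \<le> Im z} F"
      by (rule holomorphic_on_imp_continuous_on[OF F_hol])
    moreover have "F holomorphic_on upper_half_plane"
      by (rule holomorphic_on_subset[OF F_hol]) (auto simp: upper_half_plane_def)
    ultimately show thesis
      using rational_class_approx_of_decay[OF _ _ F_decay e'(1)] that by blast
  qed
  have cont: "continuous_on upper_half_plane (\<lambda>z. f z - f (z + \<i> * of_real h))"
    "continuous_on upper_half_plane (\<lambda>z. f (z + \<i> * of_real h) - F z)"
    "continuous_on upper_half_plane (\<lambda>z. F z - g z)"
  proof -
    have sub: "upper_half_plane \<subseteq> {z. 0 \<le> Im z}" by (auto simp: upper_half_plane_def)
    have "g holomorphic_on upper_half_plane"
      using g(1) rational_class_subset_hardy_space[OF p Np] by (auto simp: hardy_space_def)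
    then show "continuous_on upper_half_plane (\<lambda>z. f z - f (z + \<i> * of_real h))"
    "continuous_on upper_half_plane (\<lambda>z. f (z + \<i> * of_real h) - F z)"
    "continuous_on upper_half_plane (\<lambda>z. F z - g z)"
      by (intro holomorphic_on_imp_continuous_on holomorphic_intros hol
          holomorphic_on_subset[OF shift_f sub] holomorphic_on_subset[OF F_hol sub]; assumption)+
  qed
  show thesis
  proof (rule that[OF g(1)])
    fix y :: real assume y: "0 < y"
    define I1 where "I1 = line_integral_powr p (\<lambda>z. f z - f (z + \<i> * of_real h)) y"
    define I2 where "I2 = line_integral_powr p (\<lambda>z. f (z + \<i> * of_real h) - F z) y"
    define I3 where "I3 = line_integral_powr p (\<lambda>z. F z - g z) y"
    have I1: "I1 \<le> ennreal e" using translate[OF y] by (simp add: I1_def)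
    have I2: "I2 \<le> ennreal e"
    proof -
      have "I2 = line_integral_powr p (\<lambda>z. f z * (1 - cutoff \<eta> z ^ (N + 2))) (y + h)"
        unfolding I2_def F_def line_integral_shift_up[symmetric]
        by (simp add: right_diff_distrib)
      then show ?thesis using cut[of "y + h"] y by simp
    qed
    have I3: "I3 \<le> ennreal e"
    proof -
      have "I3 \<le> ennreal (e' powr p) * W"
        unfolding I3_def W_def by (rule line_integral_le_of_decay[OF p _ y g(2)]) (use e' in auto)
      also have "\<dots> = ennreal (e' powr p * w)" using w by (simp add: ennreal_mult)
      also have "\<dots> \<le> ennreal e" by (rule ennreal_leI[OF e'(2)])
      finally show ?thesis .
    qed
    have "line_integral_powr p (\<lambda>z. f z - g z) y =
        line_integral_powr p (\<lambda>z. (f z - f (z + \<i> * of_real h)) + ((f (z + \<i> * of_real h) - F z) + (F z - g z))) y"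
      by simp
    also have "\<dots> \<le> ennreal (2 powr p) *
        (I1 + line_integral_powr p (\<lambda>z. (f (z + \<i> * of_real h) - F z) + (F z - g z)) y)"
      unfolding I1_def by (intro line_integral_add_le continuous_on_add cont p y)
    also have "\<dots> \<le> ennreal (2 powr p) * (I1 + ennreal (2 powr p) * (I2 + I3))"
      unfolding I2_def I3_def by (intro mult_left_mono add_left_mono line_integral_add_le cont p y) auto
    also have "\<dots> \<le> ennreal (2 powr p) * (ennreal e + ennreal (2 powr p) * (ennreal e + ennreal e))"
      by (intro mult_left_mono add_mono I1 I2 I3) auto
    also have "\<dots> = ennreal (2 powr p * (e + 2 powr p * (e + e)))"
      using e by (simp flip: ennreal_plus ennreal_mult)
    also have "\<dots> \<le> ennreal \<epsilon>"
    proof (rule ennreal_leI)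
      have "1 \<le> 2 powr p" using p by (simp add: ge_one_powr_ge_zero)
      then have "2 powr p * (1 * e + 2 powr p * (e + e)) \<le> 2 powr p * (2 powr p * e + 2 powr p * (e + e))"
        using e by (intro mult_left_mono add_right_mono mult_right_mono) auto
      also have "\<dots> = \<epsilon>" by (simp add: e_def)
      finally show "2 powr p * (e + 2 powr p * (e + e)) \<le> \<epsilon>" by simp
    qed
    finally show "line_integral_powr p (\<lambda>z. f z - g z) y \<le> ennreal \<epsilon>" .
  qed
qed

lemma hardy_dist_less_if_line_integrals_small:
  assumes p: "0 < p" and \<epsilon>: "0 < \<epsilon>"
  obtains \<kappa> :: real where "0 < \<kappa>"
    "\<And>f g. (\<And>y. 0 < y \<Longrightarrow> line_integral_powr p (\<lambda>z. f z - g z) y \<le> ennreal \<kappa>) \<Longrightarrow> hardy_dist p f g < ennreal \<epsilon>"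
proof (cases "1 \<le> p")
  case True
  show thesis
  proof (rule that[of "(\<epsilon> / 2) powr p"])
    fix f g assume "\<And>y. 0 < y \<Longrightarrow> line_integral_powr p (\<lambda>z. f z - g z) y \<le> ennreal ((\<epsilon> / 2) powr p)"
    then have "hardy_norm p (\<lambda>z. f z - g z) \<le> ennreal (((\<epsilon> / 2) powr p) powr (1 / p))"
      by (intro hardy_norm_leI p) auto
    also have "\<dots> < ennreal \<epsilon>" using p \<epsilon> by (simp add: powr_powr ennreal_less_iff)
    finally show "hardy_dist p f g < ennreal \<epsilon>" using True by (simp add: hardy_dist_def)
  qed (use \<epsilon> in simp)
next
  case False
  show thesis
  proof (rule that[of "\<epsilon> / 2"])
    fix f g assume "\<And>y. 0 < y \<Longrightarrow> line_integral_powr p (\<lambda>z. f z - g z) y \<le> ennreal (\<epsilon> / 2)"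
    then have "hardy_dist p f g \<le> ennreal (\<epsilon> / 2)"
      using False by (auto simp: hardy_dist_def intro!: SUP_least)
    also have "\<dots> < ennreal \<epsilon>" using \<epsilon> by (simp add: ennreal_less_iff)
    finally show "hardy_dist p f g < ennreal \<epsilon>" .
  qed (use \<epsilon> in simp)
qed

theorem theorem1:
  fixes N :: nat and p :: real
  assumes "0 < N" and "0 < p" and "1 < real N * p"
  shows "dense_in_hardy_space p (rational_class N)"
proof -
  have Np: "1 < real (N + 1) * p"
    using assms by (simp add: distrib_right)
  have "\<exists>g\<in>rational_class N. hardy_dist p f g < ennreal \<epsilon>"
    if f: "f \<in> hardy_space p" and \<epsilon>: "0 < \<epsilon>" for f and \<epsilon> :: real
  proof -
    obtain \<kappa> where \<kappa>: "0 < \<kappa>" and small: "\<And>f g.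
        (\<And>y. 0 < y \<Longrightarrow> line_integral_powr p (\<lambda>z. f z - g z) y \<le> ennreal \<kappa>) \<Longrightarrow> hardy_dist p f g < ennreal \<epsilon>"
      using hardy_dist_less_if_line_integrals_small[OF assms(2) \<epsilon>] by blast
    obtain g where "g \<in> rational_class N" "\<And>y. 0 < y \<Longrightarrow> line_integral_powr p (\<lambda>z. f z - g z) y \<le> ennreal \<kappa>"
      using rational_class_approx[OF assms(2) Np f \<kappa>] by blast
    then show ?thesis using small by blast
  qed
  then show ?thesis
    unfolding dense_in_hardy_space_def
    using rational_class_subset_hardy_space[OF assms(2) Np] by blast
qed

end
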